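(* Let $p$ be a prime and let $G$ be a finite non-abelian $p$-group of $LC$-class $k>1$. Then $LC_{i+1}(G)/LC_i(G)$ is cyclic for each $0\le i\le k-1$ if and only if $k=2=p$ and $G$ is isomorphic to one of $D_{2^n}$, $SD_{2^n}$, $Q_{2^m}$, where $n\geq 3$ and $m\geq 4$.
   Context: $o(x)$ denotes the order of $x$. For a finite group $G$, $LCM(G)$ is the set of all $x\in G$ such that $o(x^n y)$ divides $\mathrm{lcm}(o(x^n),o(y))$ for all $y\in G$ and all integers $n$; $LC(G)$ is the subgroup generated by $LCM(G)$ (a characteristic subgroup). Put $LC_0(G)=1$, $LC_1(G)=LC(G)$, and for $i\ge 2$ define $LC_i(G)$ by $LC_i(G)/LC_{i-1}(G)=LC(G/LC_{i-1}(G))$. $G$ is $LC$-nilpotent if there is $k$ with $LC_k(G)=G$ and $LC_i(G)/LC_{i-1}(G)$ nilpotent for all $i=1,\dots,k$; it has $LC$-class $k$ if $LC_k(G)=G$ and $LC_{k-1}(G)<LC_k(G)$. $D_{2^n}$, $SD_{2^n}$, $Q_{2^n}$ denote the dihedral, semidihedral and generalized quaternion groups of order $2^n$ (semidihedral groups exist for $n\ge 4$). *)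

theory Defs
  imports "HOL-Algebra.Elementary_Groups" "HOL-Algebra.Multiplicative_Group" "HOL-Number_Theory.Cong"
begin

section \<open>The \<open>LC\<close>-series\<close>

definition LCM_set :: "('a, 'b) monoid_scheme \<Rightarrow> 'a set" where
  "LCM_set G = {x \<in> carrier G. \<forall>y \<in> carrier G. \<forall>n::int.
     group.ord G (x [^]\<^bsub>G\<^esub> n \<otimes>\<^bsub>G\<^esub> y)
       dvd lcm (group.ord G (x [^]\<^bsub>G\<^esub> n)) (group.ord G y)}"

definition LC :: "('a, 'b) monoid_scheme \<Rightarrow> 'a set" where
  "LC G = generate G (LCM_set G)"

text \<open>Each \<open>LC_series G i\<close> is a subset of \<open>carrier G\<close>: the subgroup
  \<open>LC (G Mod LC_series G i)\<close> of the quotient is pulled back along the projection.\<close>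

fun LC_series :: "('a, 'b) monoid_scheme \<Rightarrow> nat \<Rightarrow> 'a set" where
  "LC_series G 0 = {\<one>\<^bsub>G\<^esub>}"
| "LC_series G (Suc 0) = LC G"
| "LC_series G (Suc (Suc i)) =
     {x \<in> carrier G. LC_series G (Suc i) #>\<^bsub>G\<^esub> x \<in> LC (G Mod LC_series G (Suc i))}"

definition LC_factor :: "('a, 'b) monoid_scheme \<Rightarrow> nat \<Rightarrow> 'a set monoid" where
  "LC_factor G i = (G\<lparr>carrier := LC_series G (Suc i)\<rparr>) Mod LC_series G i"

primrec lower_central :: "('a, 'b) monoid_scheme \<Rightarrow> nat \<Rightarrow> 'a set" where
  "lower_central G 0 = carrier G"
| "lower_central G (Suc n) = generate G
     {x \<otimes>\<^bsub>G\<^esub> y \<otimes>\<^bsub>G\<^esub> inv\<^bsub>G\<^esub> x \<otimes>\<^bsub>G\<^esub> inv\<^bsub>G\<^esub> y | x y.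
        x \<in> lower_central G n \<and> y \<in> carrier G}"

definition nilpotent_group :: "('a, 'b) monoid_scheme \<Rightarrow> bool" where
  "nilpotent_group G \<longleftrightarrow> group G \<and> (\<exists>n. lower_central G n = {\<one>\<^bsub>G\<^esub>})"

definition LC_nilpotent :: "('a, 'b) monoid_scheme \<Rightarrow> bool" where
  "LC_nilpotent G \<longleftrightarrow>
     (\<exists>k. LC_series G k = carrier G \<and> (\<forall>i<k. nilpotent_group (LC_factor G i)))"

definition has_LC_class :: "('a, 'b) monoid_scheme \<Rightarrow> nat \<Rightarrow> bool" where
  "has_LC_class G k \<longleftrightarrow> LC_nilpotent G \<and>
     LC_series G k = carrier G \<and> LC_series G (k - 1) \<subset> LC_series G k"


section \<open>Dihedral, semidihedral and generalized quaternion 2-groups\<close>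

text \<open>A model of \<open>\<langle>a, b | a^N = 1, b\<^sup>2 = a^s, b a b\<inverse> = a^r\<rangle>\<close>, where the pair
  \<open>(i, j)\<close> with \<open>0 \<le> i < N\<close> and \<open>j \<in> {0, 1}\<close> stands for \<open>a^i b^j\<close>; thus
  \<open>a^i b^j a^k b^l = a^(i + r^j k) b^(j + l)\<close>, and \<open>b\<^sup>2\<close> is rewritten to \<open>a^s\<close> when
  \<open>j = l = 1\<close>. This is a group of order \<open>2 N\<close> if \<open>r\<^sup>2 \<equiv> 1\<close> and \<open>r s \<equiv> s\<close> modulo \<open>N\<close>.\<close>

definition cyclic_by_two :: "nat \<Rightarrow> int \<Rightarrow> int \<Rightarrow> (int \<times> nat) monoid" where
  "cyclic_by_two N r s =
     \<lparr>carrier = {0..<int N} \<times> {0, 1},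
      monoid.mult = (\<lambda>(i, j) (k, l).
        ((i + r ^ j * k + s * int ((j + l) div 2)) mod int N, (j + l) mod 2)),
      one = (0, 0)\<rparr>"

text \<open>The argument \<open>n\<close> is the exponent of the order \<open>2 ^ n\<close>.\<close>

definition dihedral_2group :: "nat \<Rightarrow> (int \<times> nat) monoid" where
  "dihedral_2group n = cyclic_by_two (2 ^ (n - 1)) (-1) 0"

definition semidihedral_2group :: "nat \<Rightarrow> (int \<times> nat) monoid" where
  "semidihedral_2group n = cyclic_by_two (2 ^ (n - 1)) (2 ^ (n - 2) - 1) 0"

definition quaternion_2group :: "nat \<Rightarrow> (int \<times> nat) monoid" where
  "quaternion_2group n = cyclic_by_two (2 ^ (n - 1)) (-1) (2 ^ (n - 2))"

lemma group_cyclic_by_two: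
  assumes N: "N > 0" and r: "[r * r = 1] (mod int N)" and s: "[r * s = s] (mod int N)"
  shows "group (cyclic_by_two N r s)"
proof -
  let ?G = "cyclic_by_two N r s"
  have mult: "(i, j) \<otimes>\<^bsub>?G\<^esub> (k, l) =
      ((i + r ^ j * k + s * int ((j + l) div 2)) mod int N, (j + l) mod 2)" for i j k l
    by (simp add: cyclic_by_two_def)
  obtain t where t: "r * r = 1 + int N * t"
    using r by (metis cong_iff_lin cong_sym)
  obtain u where u: "r * s = s + int N * u"
    using s by (metis cong_iff_lin cong_sym)
  have c1: "(x mod int N + y) mod int N = (x + y) mod int N" for x y
    by (rule mod_add_left_eq)
  have c2: "(x + z * (y mod int N)) mod int N = (x + z * y) mod int N" for x y z
    by (metis mod_add_right_eq mod_mult_right_eq)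
  show ?thesis
  proof (rule groupI)
    fix x y assume "x \<in> carrier ?G" "y \<in> carrier ?G"
    then show "x \<otimes>\<^bsub>?G\<^esub> y \<in> carrier ?G"
      using N by (auto simp: cyclic_by_two_def)
  next
    show "\<one>\<^bsub>?G\<^esub> \<in> carrier ?G"
      using N by (auto simp: cyclic_by_two_def)
  next
    fix x y z assume "x \<in> carrier ?G" "y \<in> carrier ?G" "z \<in> carrier ?G"
    moreover obtain i j k l m q where xyz: "x = (i, j)" "y = (k, l)" "z = (m, q)"
      by (metis surj_pair)
    ultimately have jlq: "j \<in> {0, 1}" "l \<in> {0, 1}" "q \<in> {0, 1}"
      by (auto simp: cyclic_by_two_def)
    let ?a = "i + r ^ j * k + s * int ((j + l) div 2) + r ^ ((j + l) mod 2) * m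
                + s * int (((j + l) mod 2 + q) div 2)"
    let ?b = "i + r ^ j * (k + r ^ l * m + s * int ((l + q) div 2))
                + s * int ((j + (l + q) mod 2) div 2)"
    have "int N dvd ?a - ?b"
      using jlq by (auto simp: algebra_simps t u)
    then have eq: "?a mod int N = ?b mod int N"
      by (simp add: mod_eq_dvd_iff)
    have L: "x \<otimes>\<^bsub>?G\<^esub> y \<otimes>\<^bsub>?G\<^esub> z = (?a mod int N, (j + l + q) mod 2)"
      by (simp add: xyz mult c1 add.assoc mod_add_left_eq)
    have "x \<otimes>\<^bsub>?G\<^esub> (y \<otimes>\<^bsub>?G\<^esub> z)
        = ((i + r ^ j * ((k + r ^ l * m + s * int ((l + q) div 2)) mod int N)
            + s * int ((j + (l + q) mod 2) div 2)) mod int N, (j + l + q) mod 2)"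
      by (simp add: xyz mult mod_add_right_eq add.assoc)
    also have "\<dots> = (?b mod int N, (j + l + q) mod 2)"
      by (metis c2 mod_add_left_eq)
    finally show "x \<otimes>\<^bsub>?G\<^esub> y \<otimes>\<^bsub>?G\<^esub> z = x \<otimes>\<^bsub>?G\<^esub> (y \<otimes>\<^bsub>?G\<^esub> z)"
      using L eq by simp
  next
    fix x assume "x \<in> carrier ?G"
    then show "\<one>\<^bsub>?G\<^esub> \<otimes>\<^bsub>?G\<^esub> x = x"
      by (auto simp: cyclic_by_two_def)
  next
    fix x assume x: "x \<in> carrier ?G"
    then obtain i j where ij: "x = (i, j)" "j = 0 \<or> j = 1"
      by (auto simp: cyclic_by_two_def)
    let ?y = "((- (r ^ j * i) - s * int j) mod int N, j)"
    have "?y \<in> carrier ?G"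
      using N ij by (auto simp: cyclic_by_two_def)
    moreover have "?y \<otimes>\<^bsub>?G\<^esub> x = \<one>\<^bsub>?G\<^esub>"
      using ij by (auto simp: mult c1 mod_simps add.assoc) (auto simp: cyclic_by_two_def)
    ultimately show "\<exists>y \<in> carrier ?G. y \<otimes>\<^bsub>?G\<^esub> x = \<one>\<^bsub>?G\<^esub>"
      by blast
  qed
qed

lemma order_cyclic_by_two: "order (cyclic_by_two N r s) = 2 * N"
  by (simp add: order_def cyclic_by_two_def card_cartesian_product)

lemma group_dihedral_2group: "group (dihedral_2group n)"
  unfolding dihedral_2group_def by (rule group_cyclic_by_two) auto

lemma group_semidihedral_2group:
  assumes "n \<ge> 3" shows "group (semidihedral_2group n)"
proof -
  obtain m where n: "n = m + 3"
    using assms by (metis add.commute le_Suc_ex)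
  have "(2 ^ (n - 2) - 1) * (2 ^ (n - 2) - 1) - 1 = (2 ^ (n - 1) :: int) * (2 ^ m - 1)"
    by (simp add: n power_add algebra_simps eval_nat_numeral)
  then have "[(2 ^ (n - 2) - 1) * (2 ^ (n - 2) - 1) = 1] (mod (2 ^ (n - 1) :: int))"
    by (metis cong_iff_dvd_diff dvd_triv_left)
  then show ?thesis
    unfolding semidihedral_2group_def by (intro group_cyclic_by_two) auto
qed

lemma group_quaternion_2group:
  assumes "n \<ge> 2" shows "group (quaternion_2group n)"
proof -
  obtain m where n: "n = m + 2"
    using assms by (metis add.commute le_Suc_ex)
  have "[- 1 * 2 ^ (n - 2) = 2 ^ (n - 2)] (mod (2 ^ (n - 1) :: int))"
    by (simp add: n cong_iff_dvd_diff)
  then show ?thesis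
    unfolding quaternion_2group_def by (intro group_cyclic_by_two) auto
qed

lemma order_2groups:
  assumes "n \<ge> 1"
  shows "order (dihedral_2group n) = 2 ^ n"
    and "order (semidihedral_2group n) = 2 ^ n"
    and "order (quaternion_2group n) = 2 ^ n"
  using assms
  by (simp_all add: dihedral_2group_def semidihedral_2group_def quaternion_2group_def
      order_cyclic_by_two flip: power_Suc)

end

theory Submission
  imports Defs "HOL-Number_Theory.Residues"
begin

text \<open>
  In a finite \<open>p\<close>-group every element that generates a normal subgroup lies in \<open>LCM_set G\<close>
  (\<open>normal_cyclic_in_LCM_set\<close>). Hence every term of the \<open>LC\<close>-series absorbs the normal cyclic
  subgroups modulo the preceding term. Suppose that all factors are cyclic, let \<open>C\<close>
  be the first term, generated by \<open>a\<close>, and let \<open>D\<close> be the second one. Inside \<open>D\<close> there is an element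
  \<open>b\<close> outside \<open>C\<close> that has order \<open>p\<close> and is central modulo \<open>C\<close>; let it act on \<open>C\<close> as the
  \<open>r\<close>-th power map.

  If \<open>p\<close> is odd, or \<open>r\<close> is \<open>1\<close> modulo \<open>4\<close>, then \<open>b\<close> can be corrected by a power of \<open>a\<close> to an
  element whose \<open>p\<close>-th power is trivial. Its commutators lie in the central subgroup of
  order \<open>p\<close> of \<open>C\<close>, and a second criterion for membership in \<open>LCM_set G\<close>
  (\<open>central_commutator_in_LCM_set\<close>) puts this element, or its product with an element of order \<open>4\<close>
  in \<open>C\<close>, into \<open>C\<close>, which is absurd. The only escapes are \<open>p = 2\<close> with \<open>C\<close> of order two, and
  \<open>p = 2\<close> with \<open>r\<close> equal to \<open>3\<close> modulo \<open>4\<close> (\<open>central_extension_of_LCM_cyclic\<close>).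

  A factor of order two below the last one is impossible: it would propagate upwards to the last
  two factors, and there the corresponding quotient of \<open>G\<close>, of order at most four, would be abelian
  and therefore absorbed in a single step (\<open>not_two_cosets\<close>). This rules out that \<open>C\<close> has order two.
  So \<open>r\<close> is \<open>3\<close> modulo \<open>4\<close>, and since this is not a square modulo \<open>4\<close>, the element \<open>b\<close> generates
  \<open>D\<close> modulo \<open>C\<close>. Then \<open>D\<close> has index two over \<open>C\<close>, and by the same principle \<open>D\<close> is the whole group. A group
  with a cyclic subgroup of index two and such an action is dihedral, semidihedral or generalized
  quaternion (\<open>maximal_class_2_group\<close>).

  Conversely, in each of these groups the cyclic subgroup of index two is normal, hence contained
  in \<open>LC G\<close>; as the class is two, \<open>LC G\<close> is proper, so it equals that subgroup
  (\<open>maximal_class_LC_series\<close>).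
\<close>

section \<open>Sums of powers modulo a prime\<close>

lemma power_prime_power_cong_self:
  fixes p r :: nat
  assumes "prime p"
  shows "[r ^ (p ^ e) = r] (mod p)"
proof (induction e)
  case (Suc e)
  have fermat: "[x ^ p = x] (mod p)" for x
  proof (cases "p dvd x")
    case True
    then have "p dvd x ^ p"
      using assms by (simp add: dvd_power_iff prime_gt_0_nat dvd_trans[OF _ dvd_power])
    then show ?thesis
      using True by (simp add: cong_def mod_eq_0_iff_dvd)
  next
    case False
    have "x ^ p = x ^ (p - 1) * x"
      using assms by (metis power_minus_mult prime_gt_0_nat)
    then show ?thesis
      using cong_scalar_right[OF fermat_theorem[OF assms False], of x] by simp
  qed
  have "r ^ p ^ Suc e = (r ^ p ^ e) ^ p"
    by (metis power_Suc2 power_mult)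
  then show ?case
    using fermat Suc.IH cong_trans by metis
qed simp

text \<open>Grouping the \<open>p ^ Suc f\<close> terms into \<open>p\<close> blocks factors the sum as the sum of length
\<open>p ^ f\<close> for \<open>r\<close> times a sum of \<open>p\<close> powers of \<open>r ^ (p ^ f)\<close>, and the latter is
congruent to \<open>p\<close>.\<close>

lemma prime_power_dvd_sum_powers:
  fixes p r :: nat
  assumes "[r = 1] (mod p)"
  shows "p ^ f dvd (\<Sum>i<p ^ f. r ^ i)"
proof (induction f)
  case (Suc f)
  have "(\<Sum>j<p. (r ^ (p ^ f)) ^ j) mod p = (\<Sum>j<p. 1) mod p"
    using assms by (metis (no_types, lifting) cong_def cong_pow cong_sum power_one)
  then have "p dvd (\<Sum>j<p. (r ^ (p ^ f)) ^ j)"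
    by (simp add: mod_eq_0_iff_dvd)
  moreover have "(\<Sum>i<p ^ Suc f. r ^ i) = (\<Sum>j<p. \<Sum>i<p ^ f. r ^ (j * p ^ f + i))"
    using sum.nat_group[of "\<lambda>i. r ^ i" "p ^ f" p]
    by (simp add: sum.atLeastLessThan_shift_0[of _ "_ * _"] atLeast0LessThan add.commute)
  then have "(\<Sum>i<p ^ Suc f. r ^ i) = (\<Sum>j<p. (r ^ (p ^ f)) ^ j) * (\<Sum>i<p ^ f. r ^ i)"
    by (simp add: power_add power_mult[symmetric] mult.commute
        sum_distrib_left[symmetric] sum_distrib_right[symmetric])
  ultimately show ?case
    using Suc.IH by (simp add: mult_dvd_mono)
qed simp

text \<open>Sharpens the case \<open>f = 1\<close> of the previous lemma: the sum is congruent to \<open>p\<close> modulo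
\<open>p\<^sup>2\<close>. For \<open>p = 2\<close> and \<open>r = 3\<close> the sum is \<open>4\<close>; this failure
is the reason why only the prime \<open>2\<close> admits exceptional groups.\<close>

lemma sum_powers_eq_prime_times_unit:
  fixes p r :: nat
  assumes p: "prime p" and r: "[r = 1] (mod p)" and odd: "odd p \<or> [r = 1] (mod 4)"
  obtains u where "(\<Sum>i<p. r ^ i) = p * u" "\<not> p dvd u"
proof -
  have "p dvd (\<Sum>i<p. r ^ i)"
    using prime_power_dvd_sum_powers[OF r, of 1] by simp
  then obtain u where u: "(\<Sum>i<p. r ^ i) = p * u" by blast
  have "\<not> p dvd u"
  proof (cases "odd p")
    case True
    then obtain q where q: "p = 2 * q + 1" by (auto elim: oddE)
    have "r \<ge> 1" 
      using r prime_gt_1_nat[OF p] by (cases "r = 0") (auto simp: cong_def)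
    then obtain t where t: "r = 1 + p * t"
      using r by (metis cong_altdef_nat dvdE le_add_diff_inverse)
    have pow: "[r ^ i = 1 + i * (p * t)] (mod p ^ 2)" for i
    proof (induction i)
      case (Suc i)
      have "[r ^ i * r = (1 + i * (p * t)) * r] (mod p ^ 2)"
        by (rule cong_scalar_right[OF Suc.IH])
      moreover have "(1 + i * (p * t)) * r = 1 + Suc i * (p * t) + p ^ 2 * (i * t * t)"
        by (simp add: t algebra_simps power2_eq_square)
      ultimately show ?case
        by (simp add: cong_def mult.commute)
    qed simp
    have "(\<Sum>i<2 * q + 1. i) = q * (2 * q + 1)"
      by (induction q) auto
    then have "(\<Sum>i<p. i * (p * t)) = q * p * (p * t)"
      by (simp only: q sum_distrib_right[symmetric])
    then have "(\<Sum>i<p. i * (p * t)) = p ^ 2 * (q * t)"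
      by (simp add: power2_eq_square)
    moreover have "[(\<Sum>i<p. r ^ i) = (\<Sum>i<p. 1 + i * (p * t))] (mod p ^ 2)"
      by (intro cong_sum pow)
    ultimately have "[p * u = p] (mod p ^ 2)"
      unfolding u sum.distrib by (simp add: cong_def)
    then have "p * (u mod p) = p * (1 mod p)"
      by (simp only: cong_def power2_eq_square mult_mod_right mult_1_right)
    then have "[u = 1] (mod p)"
      using p by (auto simp: cong_def)
    then show ?thesis
      using prime_gt_1_nat[OF p] by (auto simp: cong_def mod_eq_0_iff_dvd)
  next
    case False
    then have p2: "p = 2"
      using primes_dvd_imp_eq[OF two_is_prime_nat p] by simp
    then have "r mod 4 = 1"
      using odd by (simp add: cong_def)
    then have "r = 4 * (r div 4) + 1"
      by presburger
    then show ?thesis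
      using u by (simp add: p2 numeral_2_eq_2) presburger
  qed
  then show ?thesis
    using that u by blast
qed

section \<open>Products of a normalized element and its normalizer\<close>

lemma (in group) pow_eq_iff_cong:
  assumes "x \<in> carrier G"
  shows "x [^] (m::nat) = x [^] (n::nat) \<longleftrightarrow> [m = n] (mod ord x)"
proof -
  have "x [^] m = x [^] n \<longleftrightarrow> x [^] int m = x [^] int n"
    by (simp only: int_pow_int)
  also have "\<dots> \<longleftrightarrow> [int n = int m] (mod int (ord x))"
    by (simp only: int_pow_eq[OF assms] cong_iff_dvd_diff)
  finally show ?thesis
    by (simp only: cong_int_iff cong_sym_eq)
qed

context group
begin

text \<open>Conjugation is written without inverses: \<open>g \<otimes> x = x [^] r \<otimes> g\<close> says that \<open>g\<close> acts on
\<open>x\<close> as the \<open>r\<close>-th power map.\<close>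

lemma normalizes_pow:
  fixes r n :: nat
  assumes "g \<in> carrier G" "x \<in> carrier G" and "g \<otimes> x = x [^] r \<otimes> g"
  shows "g \<otimes> x [^] n = (x [^] n) [^] r \<otimes> g"
proof (induction n)
  case (Suc n)
  have "g \<otimes> x [^] Suc n = (g \<otimes> x [^] n) \<otimes> x"
    using assms by (simp add: m_assoc)
  also have "\<dots> = (x [^] n) [^] r \<otimes> x [^] r \<otimes> g"
    unfolding Suc using assms by (simp add: m_assoc)
  finally show ?case
    using assms by (simp only: nat_pow_pow nat_pow_mult nat_pow_closed mult_Suc add.commute)
qed (use assms in simp)

lemma pow_normalizes:
  fixes r m :: nat
  assumes "g \<in> carrier G" "x \<in> carrier G" and "g \<otimes> x = x [^] r \<otimes> g"
  shows "g [^] m \<otimes> x = x [^] (r ^ m) \<otimes> g [^] m"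
proof (induction m)
  case (Suc m)
  have "g [^] Suc m \<otimes> x = g [^] m \<otimes> (x [^] r \<otimes> g)"
    using assms by (simp add: m_assoc)
  also have "\<dots> = (g [^] m \<otimes> x [^] r) \<otimes> g"
    using assms by (simp add: m_assoc)
  also have "\<dots> = (x [^] r) [^] (r ^ m) \<otimes> g [^] m \<otimes> g"
    using normalizes_pow[OF _ _ Suc, of r] assms by simp
  finally show ?case
    using assms by (simp add: nat_pow_pow m_assoc)
qed (use assms in simp)

lemma mult_pow_normalizes:
  fixes r m :: nat
  assumes "g \<in> carrier G" "x \<in> carrier G" and "g \<otimes> x = x [^] r \<otimes> g"
  shows "(x \<otimes> g) [^] m = x [^] (\<Sum>i<m. r ^ i) \<otimes> g [^] m"
proof (induction m)
  case (Suc m)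
  have "(x \<otimes> g) [^] Suc m = x [^] (\<Sum>i<m. r ^ i) \<otimes> (g [^] m \<otimes> x) \<otimes> g"
    using assms by (simp add: Suc m_assoc)
  also have "\<dots> = x [^] (\<Sum>i<m. r ^ i) \<otimes> x [^] (r ^ m) \<otimes> (g [^] m \<otimes> g)"
    using assms(1,2) by (simp add: pow_normalizes[OF assms] m_assoc)
  finally show ?case
    using assms(1,2) by (simp add: nat_pow_mult)
qed (use assms in simp)

lemma mult_pow_central_commutator:
  fixes m :: nat
  assumes "g \<in> carrier G" "x \<in> carrier G" "c \<in> carrier G"
    and cx: "c \<otimes> x = x \<otimes> c" and cg: "c \<otimes> g = g \<otimes> c" and gx: "g \<otimes> x = c \<otimes> x \<otimes> g"
  shows "(x \<otimes> g) [^] m = c [^] (\<Sum>i<m. i) \<otimes> x [^] m \<otimes> g [^] m"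
proof (induction m)
  case (Suc m)
  have gm: "g [^] m \<otimes> x = c [^] m \<otimes> x \<otimes> g [^] m"
  proof (induction m)
    case (Suc m)
    have "g [^] Suc m \<otimes> x = g [^] m \<otimes> c \<otimes> x \<otimes> g"
      using assms by (simp add: m_assoc)
    also have "\<dots> = c \<otimes> (g [^] m \<otimes> x) \<otimes> g"
      using assms group_commutes_pow[of g c m] by (simp add: m_assoc)
    finally show ?case
      using assms Suc nat_pow_Suc2[of c m] by (simp add: m_assoc del: nat_pow_Suc)
  qed (use assms in simp)
  have xc: "x [^] m \<otimes> c [^] m = c [^] m \<otimes> x [^] m"
    using assms group_commutes_pow[of c x] group_commutes_pow[of x "c [^] m" m] by simp
  have "(x \<otimes> g) [^] Suc m = c [^] (\<Sum>i<m. i) \<otimes> x [^] m \<otimes> (g [^] m \<otimes> x) \<otimes> g"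
    using assms by (simp add: Suc m_assoc)
  also have "\<dots> = c [^] (\<Sum>i<m. i) \<otimes> (x [^] m \<otimes> c [^] m) \<otimes> x \<otimes> (g [^] m \<otimes> g)"
    using assms by (simp add: gm m_assoc)
  also have "\<dots> = c [^] (\<Sum>i<m. i) \<otimes> c [^] m \<otimes> x [^] Suc m \<otimes> g [^] Suc m"
    unfolding xc using assms by (simp add: m_assoc)
  finally show ?case
    using assms by (simp add: nat_pow_mult)
qed (use assms in simp)

end

section \<open>Groups of prime-power exponent\<close>

text \<open>A finite \<open>p\<close>-group is treated through its exponent, because this bound, unlike the order,
passes to quotients unchanged.\<close>

locale prime_exponent_group = group G for G (structure) +
  fixes p e :: nat
  assumes prime_p: "prime p" and exponent: "x \<in> carrier G \<Longrightarrow> x [^] (p ^ e) = \<one>"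
begin

lemma ord_prime_power:
  assumes "x \<in> carrier G" obtains f where "ord x = p ^ f"
proof -
  have "ord x dvd p ^ e"
    using assms exponent by (simp add: pow_eq_id[symmetric])
  then show ?thesis
    using that prime_p by (auto simp: divides_primepow_nat)
qed

lemma lcm_ord_prime_power:
  assumes "x \<in> carrier G" "y \<in> carrier G" obtains f where "lcm (ord x) (ord y) = p ^ f"
proof -
  have "lcm (ord x) (ord y) dvd p ^ e"
    using assms exponent by (intro lcm_least) (simp_all add: pow_eq_id[symmetric])
  then show ?thesis
    using that divides_primepow_nat[OF prime_p] by blast
qed

lemma prime_dvd_ord:
  assumes "x \<in> carrier G" "x \<noteq> \<one>" shows "p dvd ord x"
proof -
  obtain f where f: "ord x = p ^ f"
    using ord_prime_power[OF assms(1)] .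
  then have "f \<noteq> 0"
    using assms ord_eq_1[of x] by (cases "f = 0") auto
  then show ?thesis
    by (simp add: f)
qed

lemma int_pow_eq_nat_pow:
  assumes "x \<in> carrier G" obtains m :: nat where "x [^] (n::int) = x [^] m"
proof -
  have "int (ord x) > 0"
    using assms ord_prime_power prime_p by (metis of_nat_0_less_iff prime_gt_0_nat zero_less_power)
  then have "x [^] n = x [^] (n mod int (ord x))" "n mod int (ord x) \<ge> 0"
    using assms by (auto simp: int_pow_eq) (metis dvd_minus_mod dvd_minus_iff minus_diff_eq)
  then show ?thesis
    using that by (metis pow_nat)
qed

lemma LCM_setI:
  assumes x: "x \<in> carrier G"
    and "\<And>y n::nat. y \<in> carrier G \<Longrightarrow> (x [^] n \<otimes> y) [^] lcm (ord (x [^] n)) (ord y) = \<one>"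
  shows "x \<in> LCM_set G"
proof -
  have "ord (x [^] n \<otimes> y) dvd lcm (ord (x [^] n)) (ord y)" if y: "y \<in> carrier G" for y and n :: int
  proof -
    obtain m :: nat where "x [^] n = x [^] m" using int_pow_eq_nat_pow[OF x] .
    then show ?thesis
      using assms(2)[OF y, of m] x y by (simp add: pow_eq_id)
  qed
  then show ?thesis
    using x by (auto simp: LCM_set_def)
qed

text \<open>The exponent \<open>r\<close> has \<open>p\<close>-power order modulo \<open>p\<close>, whereas the units modulo \<open>p\<close> form
a group of order \<open>p - 1\<close>.\<close>

lemma normalizes_exponent_cong_1:
  assumes "g \<in> carrier G" "x \<in> carrier G" "x \<noteq> \<one>" and gx: "g \<otimes> x = x [^] (r::nat) \<otimes> g"
  shows "[r = 1] (mod p)"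
proof -
  have "x [^] (1::nat) = x [^] (r ^ (p ^ e))"
    using pow_normalizes[OF assms(1,2) gx, of "p ^ e"] assms exponent by simp
  then have "x [^] int 1 = x [^] int (r ^ (p ^ e))"
    by (simp only: int_pow_int)
  then have "int (ord x) dvd int (r ^ (p ^ e)) - int 1"
    by (simp only: int_pow_eq[OF assms(2)])
  then have "int p dvd int (r ^ (p ^ e)) - int 1"
    using prime_dvd_ord[OF assms(2,3)] by (metis dvd_trans int_dvd_int_iff)
  then have "[r ^ (p ^ e) = 1] (mod p)"
    by (metis cong_iff_dvd_diff cong_int_iff)
  then show ?thesis
    using power_prime_power_cong_self[OF prime_p] cong_sym cong_trans by blast
qed

lemma normal_order_p_central:
  assumes "g \<in> carrier G" "x \<in> carrier G" and xp: "x [^] p = \<one>" and gx: "g \<otimes> x = x [^] (r::nat) \<otimes> g"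
  shows "g \<otimes> x = x \<otimes> g"
proof (cases "x = \<one>")
  case False
  then have "[r = 1] (mod p)"
    using assms normalizes_exponent_cong_1 by blast
  moreover have "ord x dvd p"
    using xp assms by (simp add: pow_eq_id)
  ultimately have "int (ord x) dvd int 1 - int r"
    by (metis cong_dvd_modulus_nat cong_iff_dvd_diff cong_int_iff cong_sym)
  then have "x [^] int r = x [^] int 1"
    using assms by (simp only: int_pow_eq[OF assms(2)])
  then have "x [^] r = x" 
    using assms by (simp only: int_pow_int) simp
  then show ?thesis using gx by simp
qed (use assms in simp)

text \<open>If \<open>w\<close> is a power of \<open>x\<close> and \<open>m\<close> is the least common multiple of the orders of \<open>w\<close>
and \<open>y\<close>, then \<open>(w \<otimes> y) [^] m\<close> is \<open>w\<close> to the power \<open>1 + r + \<dots> + r ^ (m - 1)\<close>. Since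
\<open>m\<close> is a power of \<open>p\<close> and \<open>r\<close> is \<open>1\<close> modulo \<open>p\<close>, that sum is a multiple of \<open>m\<close>.\<close>

lemma normal_cyclic_in_LCM_set:
  assumes x: "x \<in> carrier G" and "\<And>g. g \<in> carrier G \<Longrightarrow> \<exists>r::nat. g \<otimes> x = x [^] r \<otimes> g"
  shows "x \<in> LCM_set G"
proof (rule LCM_setI[OF x])
  fix y n assume y: "y \<in> carrier G"
  define w m where "w = x [^] (n::nat)" and "m = lcm (ord w) (ord y)"
  have w: "w \<in> carrier G" using x by (simp add: w_def)
  obtain r :: nat where "y \<otimes> x = x [^] r \<otimes> y" using assms(2)[OF y] by blast
  then have r: "y \<otimes> w = w [^] r \<otimes> y"
    unfolding w_def using x y by (simp add: normalizes_pow)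
  have ym: "y [^] m = \<one>" 
    using y by (simp add: pow_eq_id m_def)
  have "(w \<otimes> y) [^] m = \<one>"
  proof (cases "w = \<one>")
    case False
    have "[r = 1] (mod p)"
      using normalizes_exponent_cong_1[OF y w False r] .
    moreover obtain f where "m = p ^ f"
      using lcm_ord_prime_power[OF w y] m_def by metis
    ultimately have "m dvd (\<Sum>i<m. r ^ i)"
      using prime_power_dvd_sum_powers by blast
    then have "w [^] (\<Sum>i<m. r ^ i) = \<one>"
      using w pow_eq_id by (metis dvd_lcm1 dvd_trans m_def)
    then show ?thesis
      using mult_pow_normalizes[OF y w r] ym by simp
  qed (use y ym in simp)
  then show "(x [^] n \<otimes> y) [^] lcm (ord (x [^] n)) (ord y) = \<one>"
    by (simp add: w_def m_def)
qed

text \<open>With \<open>w\<close>, \<open>y\<close> and \<open>m\<close> as before, \<open>(w \<otimes> y) [^] m\<close> is a power of \<open>z\<close> whose exponent is a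
multiple of \<open>m (m - 1) / 2\<close>. This is divisible by \<open>p\<close> if \<open>p\<close> is odd, and if \<open>4\<close>
divides \<open>m\<close>. In the dihedral group of order \<open>8\<close> a noncentral involution satisfies every
hypothesis but the last one, and it does not lie in \<open>LCM_set G\<close>.\<close>

lemma central_commutator_in_LCM_set:
  assumes x: "x \<in> carrier G" and z: "z \<in> carrier G" and zp: "z [^] p = \<one>"
    and central: "\<And>g. g \<in> carrier G \<Longrightarrow> z \<otimes> g = g \<otimes> z"
    and comm: "\<And>g. g \<in> carrier G \<Longrightarrow> \<exists>j::nat. g \<otimes> x = z [^] j \<otimes> x \<otimes> g"
    and odd: "odd p \<or> 4 dvd ord x"
  shows "x \<in> LCM_set G"
proof (rule LCM_setI[OF x])
  fix y and n :: nat assume y: "y \<in> carrier G"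
  define w m where "w = x [^] n" and "m = lcm (ord w) (ord y)"
  have w: "w \<in> carrier G" using x by (simp add: w_def)
  obtain j :: nat where j: "y \<otimes> x = z [^] j \<otimes> x \<otimes> y" using comm[OF y] by blast
  have zc: "z [^] i \<otimes> g = g \<otimes> z [^] i" if "g \<in> carrier G" for g and i :: nat
    by (rule group_commutes_pow[OF central[OF that] z that])
  define c where "c = z [^] (j * n)"
  have c: "c \<in> carrier G" using z by (simp add: c_def)
  have yw: "y \<otimes> w = c \<otimes> w \<otimes> y"
  proof -
    have "y \<otimes> x [^] n = z [^] (j * n) \<otimes> x [^] n \<otimes> y"
    proof (induction n)
      case (Suc n)
      have "y \<otimes> x [^] Suc n = z [^] (j * n) \<otimes> x [^] n \<otimes> (y \<otimes> x)"
        using x y z Suc by (simp flip: m_assoc)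
      also have "\<dots> = z [^] (j * n) \<otimes> (x [^] n \<otimes> z [^] j) \<otimes> x \<otimes> y"
        using x y z by (simp add: j m_assoc)
      also have "\<dots> = z [^] (j * n) \<otimes> z [^] j \<otimes> x [^] n \<otimes> x \<otimes> y"
        using x y z zc[of "x [^] n" j, symmetric] by (simp add: m_assoc)
      finally show ?case
        using x y z by (simp add: nat_pow_mult add.commute m_assoc)
    qed (use x y in simp)
    then show ?thesis by (simp add: w_def c_def)
  qed
  have wm: "w [^] m = \<one>" and ym: "y [^] m = \<one>" 
    using w y by (simp_all add: pow_eq_id m_def)
  obtain f where f: "m = p ^ f"
    using lcm_ord_prime_power[OF w y] m_def by metis
  have "c [^] (\<Sum>i<m. i) = \<one>"
  proof -
    consider "m = 1" | "odd p" "f > 0" | "even n" "p = 2" | "odd n" "p = 2" "4 dvd ord x"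
      using odd f prime_p primes_dvd_imp_eq[of 2 p] by fastforce
    then show ?thesis
    proof cases
      case 2
      then have "odd m" "p dvd m" using f by auto
      then obtain q where q: "m = 2 * q + 1" by (auto elim: oddE)
      have "(\<Sum>i<2 * q + 1. i) = q * (2 * q + 1)"
        by (induction q) auto
      then have "(\<Sum>i<m. i) = q * m" using q by simp
      then have "p dvd j * n * (\<Sum>i<m. i)" using \<open>p dvd m\<close> by simp
      then show ?thesis
        unfolding c_def using z zp by (metis nat_pow_pow pow_eq_id dvd_trans)
    next
      case 3
      then have "p dvd j * n" by simp
      then show ?thesis
        unfolding c_def using z zp by (metis nat_pow_one pow_eq_id dvd_trans)
    next
      case 4
      have "x [^] (n * ord w) = \<one>"
        unfolding w_def using x by (metis nat_pow_pow nat_pow_closed pow_ord_eq_1)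
      then have "4 dvd n * ord w"
        using 4 x by (metis pow_eq_id dvd_trans)
      moreover have "coprime (2 ^ 2) n"
        using 4 by (simp only: coprime_power_left_iff) simp
      ultimately have "4 dvd ord w"
        by (simp add: coprime_dvd_mult_right_iff)
      then have "4 dvd m" unfolding m_def by (meson dvd_lcmI1)
      then obtain q where q: "m = 4 * q" by blast
      have "2 dvd (\<Sum>i<4 * q. i)"
      proof (induction q)
        case (Suc q)
        have "4 * Suc q = Suc (Suc (Suc (Suc (4 * q))))" by simp
        then show ?case using Suc by (simp only: sum.lessThan_Suc) auto
      qed simp
      then have "p dvd j * n * (\<Sum>i<m. i)" using 4 q by simp
      then show ?thesis
        unfolding c_def using z zp by (metis nat_pow_pow pow_eq_id dvd_trans)
    qed simp
  qed
  moreover have "(w \<otimes> y) [^] m = c [^] (\<Sum>i<m. i) \<otimes> w [^] m \<otimes> y [^] m"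
    by (rule mult_pow_central_commutator[OF y w c _ _ yw]) (use zc w y in \<open>auto simp: c_def\<close>)
  ultimately show "(x [^] n \<otimes> y) [^] lcm (ord (x [^] n)) (ord y) = \<one>"
    using wm ym by (simp add: w_def m_def)
qed

end

section \<open>Quotients\<close>

context group
begin

lemma rcos_eq_iff:
  assumes "subgroup N G" "x \<in> carrier G" "y \<in> carrier G"
  shows "N #> x = N #> y \<longleftrightarrow> (\<exists>c\<in>N. x = c \<otimes> y)"
proof
  assume "N #> x = N #> y"
  then have "x \<in> N #> y" using assms rcos_self by blast
  then show "\<exists>c\<in>N. x = c \<otimes> y" by (auto simp: r_coset_def)
next
  assume "\<exists>c\<in>N. x = c \<otimes> y"
  then have "x \<in> N #> y" by (auto simp: r_coset_def)
  then show "N #> x = N #> y" using assms repr_independence by metis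
qed

lemma subgroup_nat_pow_closed:
  assumes "subgroup N G" "h \<in> N" shows "h [^] (n::nat) \<in> N"
  using subgroup_int_pow_closed[OF assms, of "int n"] by (simp add: int_pow_int)

lemma normal_conj_mult:
  assumes "N \<lhd> G" "n \<in> N" "g \<in> carrier G"
  obtains n' where "n' \<in> N" "g \<otimes> n = n' \<otimes> g"
proof -
  interpret normal N G by fact
  have "g \<otimes> n = (g \<otimes> n \<otimes> inv g) \<otimes> g"
    using assms mem_carrier by (simp add: m_assoc)
  moreover have "g \<otimes> n \<otimes> inv g \<in> N" using assms inv_op_closed2 by blast
  ultimately show ?thesis using that by blast
qed

text \<open>The factor is expressed by elements of the ambient group, so that no computation takes
place in the quotient of a subgroup.\<close>

lemma cyclic_factor_iff:
  assumes N: "N \<lhd> G" and M: "subgroup M G" and NM: "N \<subseteq> M"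
  shows "cyclic_group (G\<lparr>carrier := M\<rparr> Mod N) \<longleftrightarrow>
    (\<exists>h\<in>M. \<forall>x\<in>M. \<exists>n::int. \<exists>c\<in>N. x = c \<otimes> h [^] n)"
proof -
  let ?K = "G\<lparr>carrier := M\<rparr>"
  interpret M: subgroup M G by fact
  interpret K: normal N ?K using normal_restrict_supergroup[OF M N NM] .
  interpret Q: group "?K Mod N" by (rule K.factorgroup_is_group)
  have coset: "N #>\<^bsub>?K\<^esub> x = N #> x" for x by (simp add: r_coset_def)
  have carrier: "carrier (?K Mod N) = (\<lambda>x. N #> x) ` M"
    by (simp add: carrier_FactGroup coset)
  have pow: "(N #> h) [^]\<^bsub>?K Mod N\<^esub> n = N #> h [^] n" if "h \<in> M" for h and n :: int
    using K.FactGroup_int_pow[of h n] that int_pow_consistent[OF M that, of n] by (simp add: coset)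
  have pow_closed: "h [^] n \<in> M" if "h \<in> M" for h and n :: int
    using M that subgroup_int_pow_closed by blast
  have "cyclic_group (?K Mod N) \<longleftrightarrow>
      (\<exists>h\<in>M. (\<lambda>x. N #> x) ` M = range (\<lambda>n::int. N #> h [^] n))"
    unfolding Q.cyclic_group carrier by (simp add: pow)
  also have "\<dots> \<longleftrightarrow> (\<exists>h\<in>M. \<forall>x\<in>M. \<exists>n::int. N #> x = N #> h [^] n)"
  proof (intro bex_cong refl)
    fix h assume "h \<in> M"
    then have "range (\<lambda>n::int. N #> h [^] n) \<subseteq> (\<lambda>x. N #> x) ` M"
      by (intro image_subsetI imageI pow_closed)
    then have "(\<lambda>x. N #> x) ` M = range (\<lambda>n::int. N #> h [^] n) \<longleftrightarrow>
        (\<lambda>x. N #> x) ` M \<subseteq> range (\<lambda>n::int. N #> h [^] n)"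
      by (simp add: set_eq_subset)
    then show "(\<lambda>x. N #> x) ` M = range (\<lambda>n::int. N #> h [^] n) \<longleftrightarrow>
        (\<forall>x\<in>M. \<exists>n::int. N #> x = N #> h [^] n)"
      by (simp add: image_subset_iff image_iff)
  qed
  also have "\<dots> \<longleftrightarrow> (\<exists>h\<in>M. \<forall>x\<in>M. \<exists>n::int. \<exists>c\<in>N. x = c \<otimes> h [^] n)"
    using normal_imp_subgroup[OF N] by (intro bex_cong ball_cong ex_cong1 refl rcos_eq_iff) auto
  finally show ?thesis .
qed

lemma normal_preimage:
  assumes N: "N \<lhd> G" and L: "L \<lhd> G Mod N"
  shows "{x \<in> carrier G. N #> x \<in> L} \<lhd> G" (is "?M \<lhd> G")
proof -
  interpret N: normal N G by fact
  interpret L: normal L "G Mod N" by fact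
  interpret \<pi>: group_hom G "G Mod N" "\<lambda>x. N #> x"
    by unfold_locales (rule N.r_coset_hom_Mod)
  have "subgroup ?M G"
  proof
    fix x assume "x \<in> ?M"
    then show "inv x \<in> ?M"
      using \<pi>.hom_inv[of x] L.m_inv_closed by auto
  next
    fix x y assume "x \<in> ?M" "y \<in> ?M"
    then show "x \<otimes> y \<in> ?M"
      using \<pi>.hom_mult[of x y] L.m_closed by (auto simp del: mult_FactGroup)
  qed (use \<pi>.hom_one L.one_closed in \<open>auto simp del: one_FactGroup\<close>)
  moreover have "g \<otimes> x \<otimes> inv g \<in> ?M" if "g \<in> carrier G" "x \<in> ?M" for g x
    using that L.inv_op_closed2[of "N #> g" "N #> x"] \<pi>.hom_closed[of g]
    by (simp del: mult_FactGroup flip: \<pi>.hom_inv \<pi>.hom_mult)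
  ultimately show ?thesis by (rule normal_invI)
qed

end

lemma (in prime_exponent_group) prime_exponent_quotient:
  assumes "N \<lhd> G" shows "prime_exponent_group (G Mod N) p e"
proof -
  interpret N: normal N G by fact
  interpret Q: group "G Mod N" by (rule N.factorgroup_is_group)
  show ?thesis
  proof
    fix X assume "X \<in> carrier (G Mod N)"
    then obtain x where x: "x \<in> carrier G" "X = N #> x" by (auto simp: carrier_FactGroup)
    then show "X [^]\<^bsub>G Mod N\<^esub> (p ^ e) = \<one>\<^bsub>G Mod N\<^esub>"
      using exponent by (simp add: N.FactGroup_pow N.subset)
  qed (rule prime_p)
qed

section \<open>The series consists of normal subgroups that absorb normal cyclic subgroups\<close>

context group
begin

lemma LCM_set_subset: "LCM_set G \<subseteq> carrier G"
  by (auto simp: LCM_set_def)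

lemma LCM_set_conj_closed:
  assumes "x \<in> LCM_set G" "g \<in> carrier G"
  shows "g \<otimes> x \<otimes> inv g \<in> LCM_set G"
proof -
  define \<phi> where "\<phi> y = g \<otimes> y \<otimes> inv g" for y
  have cancel: "inv g \<otimes> (g \<otimes> y) = y" if "y \<in> carrier G" for y
    using assms that by (simp flip: m_assoc)
  interpret \<phi>: group_hom G G \<phi>
    using assms cancel by unfold_locales (auto simp: hom_def \<phi>_def m_assoc)
  have one: "\<phi> y = \<one> \<longleftrightarrow> y = \<one>" if "y \<in> carrier G" for y
  proof
    have "inv g \<otimes> (\<phi> y \<otimes> g) = y"
      using assms(2) that by (simp add: \<phi>_def m_assoc cancel)
    then show "y = \<one>" if "\<phi> y = \<one>"
      using assms(2) that by simp
  qed simp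
  have ord: "ord (\<phi> y) = ord y" if "y \<in> carrier G" for y
    using that one by (subst ord_unique) (auto simp: pow_eq_id simp flip: \<phi>.hom_nat_pow)
  have "ord (\<phi> x [^] n \<otimes> y) dvd lcm (ord (\<phi> x [^] n)) (ord y)" if y: "y \<in> carrier G" for y and n :: int
  proof -
    define y' where "y' = inv g \<otimes> y \<otimes> g"
    have y': "y' \<in> carrier G" "y = \<phi> y'"
      using assms y by (auto simp: y'_def \<phi>_def m_assoc) (simp flip: m_assoc)
    have x: "x \<in> carrier G" "ord (x [^] n \<otimes> y') dvd lcm (ord (x [^] n)) (ord y')"
      using assms y' by (auto simp: LCM_set_def)
    have "\<phi> x [^] n \<otimes> y = \<phi> (x [^] n \<otimes> y')" "\<phi> x [^] n = \<phi> (x [^] n)"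
      using x y' by (simp_all add: \<phi>.hom_int_pow)
    then show ?thesis
      using x y' by (simp only: ord m_closed int_pow_closed)
  qed
  moreover have "\<phi> x \<in> carrier G"
    using assms LCM_set_subset by (auto simp: \<phi>_def)
  ultimately have "\<phi> x \<in> LCM_set G"
    by (simp add: LCM_set_def)
  then show ?thesis by (simp add: \<phi>_def)
qed

lemma LC_normal: "LC G \<lhd> G"
  unfolding LC_def using LCM_set_subset LCM_set_conj_closed by (intro normal_generateI) auto

end

lemma LC_series_normal:
  assumes "group G" shows "LC_series G i \<lhd> G"
proof (induction i rule: nat_less_induct)
  case (1 i)
  interpret group G by fact
  consider "i = 0" | "i = 1" | j where "i = Suc (Suc j)"
    by (metis One_nat_def not0_implies_Suc)
  then show ?case
  proof cases
    case 3
    then have N: "LC_series G (Suc j) \<lhd> G" using 1 by simp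
    show ?thesis
      unfolding 3 LC_series.simps
      by (rule normal_preimage[OF N group.LC_normal[OF normal.factorgroup_is_group[OF N]]])
  qed (simp_all add: one_is_normal LC_normal)
qed

context group
begin

lemma LC_series_mono_Suc: "LC_series G i \<subseteq> LC_series G (Suc i)"
proof (cases i)
  case 0
  have "subgroup (LC G) G" using LC_normal normal_imp_subgroup by blast
  then show ?thesis using 0 by (simp add: subgroup.one_closed)
next
  case (Suc j)
  let ?N = "LC_series G i"
  have N: "?N \<lhd> G" using LC_series_normal group_axioms by blast
  have "?N \<in> LC (G Mod ?N)"
    using subgroup.one_closed[OF normal_imp_subgroup[OF group.LC_normal[OF normal.factorgroup_is_group[OF N]]]]
    by simp
  moreover have "?N #> x = ?N" "x \<in> carrier G" if "x \<in> ?N" for x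
    using that coset_join2[OF _ normal_imp_subgroup[OF N]] subgroup.mem_carrier[OF normal_imp_subgroup[OF N]]
    by auto
  ultimately show ?thesis using Suc by auto
qed

lemma LC_series_stationary:
  assumes "LC_series G (Suc i) = LC_series G (Suc (Suc i))" "i < j"
  shows "LC_series G j = LC_series G (Suc i)"
  using \<open>i < j\<close>
proof (induction j)
  case (Suc j)
  show ?case
  proof (cases "i = j")
    case False
    then have IH: "LC_series G j = LC_series G (Suc i)" using Suc by simp
    obtain l where "j = Suc l" using False Suc.prems by (cases j) auto
    then have "LC_series G (Suc j) = LC_series G (Suc (Suc i))" using IH by simp
    then show ?thesis by (simp only: assms(1)[symmetric])
  qed simp
qed simp

end

context prime_exponent_group
begin

text \<open>The hypothesis says that the image of \<open>x\<close> generates a normal subgroup of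
\<open>G Mod LC_series G i\<close>. The quotient inherits the exponent, so the criterion for
normal cyclic subgroups applies to it.\<close>

lemma LC_series_absorbs:
  assumes x: "x \<in> carrier G"
    and comm: "\<And>g. g \<in> carrier G \<Longrightarrow> \<exists>r::nat. \<exists>c\<in>LC_series G i. g \<otimes> x = c \<otimes> x [^] r \<otimes> g"
  shows "x \<in> LC_series G (Suc i)"
proof (cases i)
  case 0
  have "\<exists>r::nat. g \<otimes> x = x [^] r \<otimes> g" if "g \<in> carrier G" for g
    using comm[OF that] 0 x by auto
  then have "x \<in> LCM_set G" using normal_cyclic_in_LCM_set x by blast
  then show ?thesis using 0 by (simp add: LC_def generate.incl)
next
  case (Suc j)
  let ?N = "LC_series G i"
  have N: "?N \<lhd> G" using LC_series_normal is_group by blast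
  interpret N: normal ?N G by fact
  interpret Q: prime_exponent_group "G Mod ?N" p e by (rule prime_exponent_quotient[OF N])
  interpret \<pi>: group_hom G "G Mod ?N" "\<lambda>x. ?N #> x"
    by unfold_locales (rule N.r_coset_hom_Mod)
  have "?N #> x \<in> LCM_set (G Mod ?N)"
  proof (rule Q.normal_cyclic_in_LCM_set)
    fix X assume "X \<in> carrier (G Mod ?N)"
    then obtain g where g: "g \<in> carrier G" "X = ?N #> g" by (auto simp: carrier_FactGroup)
    obtain r :: nat and c where rc: "c \<in> ?N" "g \<otimes> x = c \<otimes> x [^] r \<otimes> g" using comm g by blast
    have "?N #> (g \<otimes> x) = ?N #> (x [^] r \<otimes> g)"
      using rc g x N.mem_carrier by (subst rcos_eq_iff) (auto simp: m_assoc N.subgroup_axioms)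
    then have "X \<otimes>\<^bsub>G Mod ?N\<^esub> (?N #> x) = (?N #> x) [^]\<^bsub>G Mod ?N\<^esub> r \<otimes>\<^bsub>G Mod ?N\<^esub> X"
      using g x by (simp add: \<pi>.hom_mult \<pi>.hom_nat_pow del: mult_FactGroup)
    then show "\<exists>r::nat. X \<otimes>\<^bsub>G Mod ?N\<^esub> (?N #> x) = (?N #> x) [^]\<^bsub>G Mod ?N\<^esub> r \<otimes>\<^bsub>G Mod ?N\<^esub> X" ..
  qed (use x in simp)
  then show ?thesis using Suc x by (simp add: LC_def generate.incl)
qed

lemma cyclic_LC_factorE:
  assumes "cyclic_group (LC_factor G i)"
  obtains h where "h \<in> LC_series G (Suc i)"
    and "\<And>x. x \<in> LC_series G (Suc i) \<Longrightarrow> \<exists>n::nat. \<exists>c\<in>LC_series G i. x = c \<otimes> h [^] n"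
proof -
  have N: "LC_series G i \<lhd> G" and M: "LC_series G (Suc i) \<lhd> G" 
    using LC_series_normal is_group by blast+
  obtain h where h: "h \<in> LC_series G (Suc i)"
    "\<And>x. x \<in> LC_series G (Suc i) \<Longrightarrow> \<exists>n::int. \<exists>c\<in>LC_series G i. x = c \<otimes> h [^] n"
    using assms cyclic_factor_iff[OF N normal_imp_subgroup[OF M] LC_series_mono_Suc]
    unfolding LC_factor_def by blast
  then have hc: "h \<in> carrier G" using M by (meson normal_imp_subgroup subgroup.mem_carrier)
  show ?thesis
    using that[OF h(1)] h(2) int_pow_eq_nat_pow[OF hc] by metis
qed

end

section \<open>Factors of order two in a series with cyclic factors\<close>

text \<open>For subgroups \<open>N \<subseteq> M\<close> this says that the index of \<open>N\<close> in \<open>M\<close> is at most two.\<close>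

definition (in group) at_most_two_cosets :: "'a set \<Rightarrow> 'a set \<Rightarrow> bool" where
  "at_most_two_cosets N M \<longleftrightarrow> (\<forall>x\<in>M - N. \<forall>y\<in>M - N. x \<otimes> y \<in> N)"

context group
begin

lemma at_most_two_cosetsI:
  assumes M: "M \<lhd> G" and h: "h \<in> carrier G" "h [^] (2::nat) \<in> M"
    and hL: "\<And>x. x \<in> L \<Longrightarrow> \<exists>n::nat. \<exists>c\<in>M. x = c \<otimes> h [^] n"
  shows "at_most_two_cosets M L"
proof -
  interpret M: normal M G by fact
  note hc = h(1)
  have h2: "h [^] (2 * n) \<in> M" for n :: nat
    using h subgroup_nat_pow_closed[OF M.subgroup_axioms, of "h [^] (2::nat)" n] by (simp add: nat_pow_pow)
  have "x \<otimes> y \<in> M" if xy: "x \<in> L - M" "y \<in> L - M" for x y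
  proof -
    obtain n c where c: "c \<in> M" "x = c \<otimes> h [^] (n::nat)" using hL xy by blast
    obtain m d where d: "d \<in> M" "y = d \<otimes> h [^] (m::nat)" using hL xy by blast
    have "odd n" "odd m"
      using c d h2 xy M.m_closed by (auto elim!: evenE)
    then obtain k where k: "n + m = 2 * k" by (metis evenE odd_even_add)
    obtain d' where d': "d' \<in> M" "h [^] n \<otimes> d = d' \<otimes> h [^] n"
      using normal_conj_mult[OF M d(1), of "h [^] n"] hc by blast
    have cc: "c \<in> carrier G" "d \<in> carrier G" "d' \<in> carrier G" using c d d' M.mem_carrier by auto
    have "x \<otimes> y = c \<otimes> (h [^] n \<otimes> d) \<otimes> h [^] m"
      using c d cc hc by (simp add: m_assoc)
    also have "\<dots> = c \<otimes> d' \<otimes> h [^] (2 * k)"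
      using cc hc by (simp add: d' m_assoc nat_pow_mult k)
    finally show ?thesis using c d' h2 M.m_closed by simp
  qed
  then show ?thesis unfolding at_most_two_cosets_def by blast
qed

text \<open>A normal subgroup of order at most two is central; the conclusion states this for the
image of \<open>M\<close> in \<open>G Mod N\<close>, in two forms.\<close>

lemma two_cosets_commutator:
  assumes N: "N \<lhd> G" and M: "M \<lhd> G" and two: "at_most_two_cosets N M"
    and "m \<in> M" "g \<in> carrier G"
  obtains m' where "m' \<in> M" "g \<otimes> m = m' \<otimes> g" "m \<otimes> m' \<in> N" "m' \<otimes> inv m \<in> N"
proof -
  interpret N: normal N G by fact
  interpret M: normal M G by fact
  define m' where "m' = g \<otimes> m \<otimes> inv g"
  have m: "m \<in> carrier G" using M.mem_carrier assms by blast
  have m': "m' \<in> M" using assms M.inv_op_closed2 m'_def by blast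
  have eq: "g \<otimes> m = m' \<otimes> g" using assms m by (simp add: m'_def m_assoc)
  have "m = inv g \<otimes> m' \<otimes> g" using assms m m' M.mem_carrier by (simp add: m_assoc flip: eq) (simp flip: m_assoc)
  then have iff: "m \<in> N \<longleftrightarrow> m' \<in> N"
    using N.inv_op_closed1 N.inv_op_closed2 assms m'_def by metis
  have im: "inv m \<in> N \<longleftrightarrow> m \<in> N" "inv m \<in> M" using m assms N.m_inv_closed by (metis inv_inv, simp)
  have "m \<otimes> m' \<in> N" "m' \<otimes> inv m \<in> N"
    using two iff im m' assms N.m_closed unfolding at_most_two_cosets_def by (metis DiffI)+
  then show ?thesis using that m' eq by blast
qed

end

context prime_exponent_group
begin

text \<open>Let \<open>N \<subseteq> M \<subseteq> L\<close> be the three terms and \<open>h\<close> a generator of \<open>L\<close> modulo \<open>M\<close>. As \<open>M\<close>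
is central of exponent two modulo \<open>N\<close>, squaring modulo \<open>N\<close> ignores the factor from \<open>M\<close>, so
the square of \<open>h\<close> generates a normal subgroup modulo \<open>N\<close> and is absorbed by \<open>M\<close>.\<close>

lemma two_cosets_Suc:
  assumes two: "at_most_two_cosets (LC_series G i) (LC_series G (Suc i))"
    and cyc: "cyclic_group (LC_factor G (Suc i))"
  shows "at_most_two_cosets (LC_series G (Suc i)) (LC_series G (Suc (Suc i)))"
proof -
  define N M L where "N = LC_series G i" and "M = LC_series G (Suc i)" and "L = LC_series G (Suc (Suc i))"
  have normal: "N \<lhd> G" "M \<lhd> G" "L \<lhd> G"
    using LC_series_normal is_group by (simp_all only: N_def M_def L_def)
  interpret N: normal N G by fact
  interpret M: normal M G by fact
  interpret L: normal L G by fact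
  have two: "at_most_two_cosets N M" using two by (simp add: N_def M_def)
  obtain h where h: "h \<in> L" and hL: "\<And>x. x \<in> L \<Longrightarrow> \<exists>n::nat. \<exists>c\<in>M. x = c \<otimes> h [^] n"
    using cyclic_LC_factorE[OF cyc] unfolding L_def M_def by metis
  have hc: "h \<in> carrier G" using h L.mem_carrier by blast
  have "h [^] (2::nat) \<in> LC_series G (Suc i)"
  proof (rule LC_series_absorbs)
    fix g assume g: "g \<in> carrier G"
    obtain h' where h': "h' \<in> L" "g \<otimes> h = h' \<otimes> g"
      using normal_conj_mult[OF normal(3) h g] .
    obtain r :: nat and c where c: "c \<in> M" "h' = c \<otimes> h [^] r" using hL h' by blast
    obtain c' where c': "c' \<in> M" "h [^] r \<otimes> c = c' \<otimes> h [^] r" "c \<otimes> c' \<in> N"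
      using two_cosets_commutator[OF normal(1,2) two c(1), of "h [^] r"] hc by blast
    have cc: "c \<in> carrier G" "c' \<in> carrier G" using c c' M.mem_carrier by auto
    have "g \<otimes> h [^] (2::nat) = (g \<otimes> h) \<otimes> h"
      using g hc by (simp add: numeral_2_eq_2 m_assoc)
    also have "\<dots> = c \<otimes> h [^] r \<otimes> (g \<otimes> h)"
      using g hc cc h' c by (simp add: m_assoc)
    also have "\<dots> = c \<otimes> (h [^] r \<otimes> c) \<otimes> h [^] r \<otimes> g"
      using g hc cc h' c by (simp add: m_assoc)
    also have "\<dots> = (c \<otimes> c') \<otimes> (h [^] r \<otimes> h [^] r) \<otimes> g"
      using g hc cc by (simp add: m_assoc c')
    also have "h [^] r \<otimes> h [^] r = (h [^] (2::nat)) [^] r"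
      using hc by (simp add: nat_pow_mult nat_pow_pow mult_2)
    finally show "\<exists>r::nat. \<exists>c\<in>LC_series G i. g \<otimes> h [^] (2::nat) = c \<otimes> (h [^] (2::nat)) [^] r \<otimes> g"
      using c' unfolding N_def by blast
  qed (use hc in simp)
  then show ?thesis
    using at_most_two_cosetsI[OF normal(2) hc _ hL] unfolding M_def L_def by blast
qed

text \<open>Modulo the lower term the group is cyclic over a central subgroup, hence abelian, so it
is absorbed in one step.\<close>

lemma two_cosets_top:
  assumes two: "at_most_two_cosets (LC_series G i) (LC_series G (Suc i))"
    and cyc: "cyclic_group (LC_factor G (Suc i))"
    and top: "LC_series G (Suc (Suc i)) = carrier G"
  shows "LC_series G (Suc i) = carrier G"
proof -
  define N M where "N = LC_series G i" and "M = LC_series G (Suc i)"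
  have normal: "N \<lhd> G" "M \<lhd> G"
    using LC_series_normal is_group by (auto simp: N_def M_def)
  interpret N: normal N G by fact
  interpret M: normal M G by fact
  have two: "at_most_two_cosets N M" using two by (simp add: N_def M_def)
  obtain h where h: "h \<in> carrier G" and hL: "\<And>x. x \<in> carrier G \<Longrightarrow> \<exists>n::nat. \<exists>c\<in>M. x = c \<otimes> h [^] n"
    using cyclic_LC_factorE[OF cyc] unfolding top M_def by metis
  have "h \<in> LC_series G (Suc i)"
  proof (rule LC_series_absorbs[OF h])
    fix g assume g: "g \<in> carrier G"
    obtain n c where c: "c \<in> M" "g = c \<otimes> h [^] (n::nat)" using hL g by blast
    obtain c' where c': "c' \<in> M" "h \<otimes> c = c' \<otimes> h" "c' \<otimes> inv c \<in> N"
      using two_cosets_commutator[OF normal two c(1) h] by blast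
    have cc: "c \<in> carrier G" "c' \<in> carrier G" using c c' M.mem_carrier by auto
    have "inv (c' \<otimes> inv c) \<otimes> h [^] (1::nat) \<otimes> g = c \<otimes> inv c' \<otimes> (h \<otimes> c) \<otimes> h [^] n"
      using cc h by (simp add: c inv_mult_group m_assoc)
    also have "\<dots> = c \<otimes> (h \<otimes> h [^] n)"
      using cc h by (simp add: c' m_assoc inv_solve_left')
    also have "\<dots> = g \<otimes> h"
      using cc h nat_pow_Suc2[of h n] by (simp add: c m_assoc)
    finally have "g \<otimes> h = inv (c' \<otimes> inv c) \<otimes> h [^] (1::nat) \<otimes> g" by simp
    moreover have "inv (c' \<otimes> inv c) \<in> N" using c' N.m_inv_closed by blast
    ultimately show "\<exists>r::nat. \<exists>c\<in>LC_series G i. g \<otimes> h = c \<otimes> h [^] r \<otimes> g"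
      unfolding N_def by blast
  qed
  then have "h [^] n \<in> M" for n :: nat unfolding M_def[symmetric] by (rule subgroup_nat_pow_closed[OF M.subgroup_axioms])
  then show ?thesis using hL M.subset M.m_closed unfolding M_def by blast
qed

text \<open>A factor of order at most two would force all later ones to have order at most two,
and then the last but one term would already be the whole group.\<close>

lemma not_two_cosets:
  assumes cyc: "\<And>i. i < k \<Longrightarrow> cyclic_group (LC_factor G i)"
    and top: "LC_series G k = carrier G" and proper: "LC_series G (k - 1) \<noteq> carrier G"
    and "i + 2 \<le> k"
  shows "\<not> at_most_two_cosets (LC_series G i) (LC_series G (Suc i))"
proof
  assume two: "at_most_two_cosets (LC_series G i) (LC_series G (Suc i))"
  obtain j where k: "k = Suc (Suc (i + j))"
    using \<open>i + 2 \<le> k\<close> by (metis add_2_eq_Suc' add_Suc le_iff_add)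
  have "at_most_two_cosets (LC_series G (i + d)) (LC_series G (Suc (i + d)))" if "d \<le> j" for d
    using that
  proof (induction d)
    case (Suc d)
    then show ?case using two_cosets_Suc[of "i + d"] cyc[of "Suc (i + d)"] k by simp
  qed (use two in simp)
  then show False
    using two_cosets_top[of "i + j"] cyc[of "Suc (i + j)"] top proper k by simp
qed

end

section \<open>Central extensions of a cyclic normal subgroup by an element of order \<open>p\<close>\<close>

context prime_exponent_group
begin

text \<open>A normal cyclic subgroup of \<open>G Mod N\<close> contains a subgroup of order \<open>p\<close>, which is
again normal, hence central.\<close>

lemma cyclic_section_order_p:
  assumes N: "N \<lhd> G" and D: "D \<lhd> G" and h: "h \<in> D" "h \<notin> N"
    and D_cyclic: "\<And>x. x \<in> D \<Longrightarrow> \<exists>n::nat. \<exists>c\<in>N. x = c \<otimes> h [^] n"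
  obtains t where "h [^] (p ^ t) \<notin> N" "(h [^] (p ^ t)) [^] p \<in> N"
    "\<And>g. g \<in> carrier G \<Longrightarrow> \<exists>c\<in>N. g \<otimes> h [^] (p ^ t) = c \<otimes> h [^] (p ^ t) \<otimes> g"
proof -
  interpret N: normal N G by fact
  interpret D: normal D G by fact
  interpret Q: prime_exponent_group "G Mod N" p e by (rule prime_exponent_quotient[OF N])
  interpret \<pi>: group_hom G "G Mod N" "\<lambda>x. N #> x"
    by unfold_locales (rule N.r_coset_hom_Mod)
  have hc: "h \<in> carrier G" using h D.mem_carrier by blast
  have "h [^] (p ^ e) \<in> N" using exponent[OF hc] by simp
  then have "\<exists>t. h [^] (p ^ Suc t) \<in> N \<and> h [^] (p ^ t) \<notin> N"
    using h(2) hc ex_least_nat_less[of "\<lambda>t. h [^] (p ^ t) \<in> N" e] by auto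
  then obtain t where t: "h [^] (p ^ Suc t) \<in> N" "h [^] (p ^ t) \<notin> N" by blast
  define k where "k = h [^] (p ^ t)"
  have k: "k \<in> carrier G" "k \<notin> N" using t hc by (auto simp: k_def)
  have kp: "k [^] p \<in> N" using t(1) hc by (simp add: k_def nat_pow_pow mult.commute)
  have "\<exists>c\<in>N. g \<otimes> k = c \<otimes> k \<otimes> g" if g: "g \<in> carrier G" for g
  proof -
    obtain h' where h': "h' \<in> D" "g \<otimes> h = h' \<otimes> g" using normal_conj_mult[OF D h(1) g] .
    obtain r :: nat and c where c: "c \<in> N" "h' = c \<otimes> h [^] r" using D_cyclic h' by blast
    have "N #> (g \<otimes> h) = N #> (h [^] r \<otimes> g)"
      using c h' hc g N.mem_carrier by (subst rcos_eq_iff) (auto simp: m_assoc N.subgroup_axioms)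
    then have "(N #> g) \<otimes>\<^bsub>G Mod N\<^esub> (N #> h) = (N #> h) [^]\<^bsub>G Mod N\<^esub> r \<otimes>\<^bsub>G Mod N\<^esub> (N #> g)"
      using g hc by (simp add: \<pi>.hom_mult \<pi>.hom_nat_pow del: mult_FactGroup)
    then have "(N #> g) \<otimes>\<^bsub>G Mod N\<^esub> (N #> k) = (N #> k) [^]\<^bsub>G Mod N\<^esub> r \<otimes>\<^bsub>G Mod N\<^esub> (N #> g)"
      using Q.normalizes_pow[of "N #> g" "N #> h" r "p ^ t"] g hc
      by (simp add: k_def N.FactGroup_pow del: mult_FactGroup)
    moreover have "(N #> k) [^]\<^bsub>G Mod N\<^esub> p = \<one>\<^bsub>G Mod N\<^esub>"
      using N.FactGroup_pow[OF k(1), of p] coset_join2[OF _ N.subgroup_axioms kp] k(1) by simp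
    ultimately have "(N #> g) \<otimes>\<^bsub>G Mod N\<^esub> (N #> k) = (N #> k) \<otimes>\<^bsub>G Mod N\<^esub> (N #> g)"
      using Q.normal_order_p_central[of "N #> g" "N #> k" r] g k by (simp del: mult_FactGroup)
    then have "N #> (g \<otimes> k) = N #> (k \<otimes> g)"
      using g k by (simp del: mult_FactGroup)
    then obtain c where "c \<in> N" "g \<otimes> k = c \<otimes> (k \<otimes> g)"
      using rcos_eq_iff[OF N.subgroup_axioms m_closed[OF g k(1)] m_closed[OF k(1) g]] by blast
    then show ?thesis
      using g k N.mem_carrier by (auto simp: m_assoc)
  qed
  then show ?thesis using that t kp unfolding k_def by blast
qed

text \<open>Write \<open>g \<otimes> x = a [^] t \<otimes> x \<otimes> g\<close>. The conjugate \<open>a [^] t \<otimes> x\<close> of \<open>x\<close> has its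
\<open>p\<close>-th power equal to \<open>\<one>\<close>, which makes \<open>a [^] (t * p * u)\<close> trivial. As \<open>u\<close> is prime to \<open>p\<close>,
\<open>a [^] t\<close> lies in the subgroup of order \<open>p\<close>.\<close>

lemma order_p_complement_commutators:
  assumes C: "C \<lhd> G" and a: "a \<in> C" and C_cyclic: "\<And>x. x \<in> C \<Longrightarrow> \<exists>n::nat. x = a [^] n"
    and x: "x \<in> carrier G" and xp: "x [^] p = \<one>" and xa: "x \<otimes> a = a [^] (r::nat) \<otimes> x"
    and comm: "\<And>g. g \<in> carrier G \<Longrightarrow> \<exists>c\<in>C. g \<otimes> x = c \<otimes> x \<otimes> g"
    and a1: "a \<noteq> \<one>" and u: "(\<Sum>i<p. r ^ i) = p * u" "\<not> p dvd u"
    and g: "g \<in> carrier G"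
  shows "\<exists>j::nat. g \<otimes> x = (a [^] (ord a div p)) [^] j \<otimes> x \<otimes> g"
proof -
  interpret C: normal C G by fact
  have ac: "a \<in> carrier G" using a C.mem_carrier by blast
  obtain t :: nat where t: "g \<otimes> x = a [^] t \<otimes> x \<otimes> g"
    using comm[OF g] C_cyclic by blast
  have "g \<otimes> x [^] m = (a [^] t \<otimes> x) [^] m \<otimes> g" for m :: nat
  proof (induction m)
    case (Suc m)
    have "g \<otimes> x [^] Suc m = (a [^] t \<otimes> x) [^] m \<otimes> (g \<otimes> x)"
      using g x ac by (simp add: Suc flip: m_assoc)
    then show ?case using g x ac by (simp add: t m_assoc)
  qed (use g in simp)
  from this[of p] have "(a [^] t \<otimes> x) [^] p \<otimes> g = \<one> \<otimes> g"
    using xp g by simp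
  then have "(a [^] t \<otimes> x) [^] p = \<one>"
    using g x ac by (simp only: right_cancel m_closed nat_pow_closed one_closed)
  moreover have "x \<otimes> a [^] t = (a [^] t) [^] r \<otimes> x"
    using normalizes_pow[OF x ac xa] .
  ultimately have "(a [^] t) [^] (p * u) = \<one>"
    using mult_pow_normalizes[of x "a [^] t" r p] x ac xp u by simp
  then have "ord a dvd t * (p * u)"
    using ac by (simp add: nat_pow_pow pow_eq_id)
  moreover obtain f where f: "ord a = p * p ^ f"
  proof -
    obtain n where n: "ord a = p ^ n" using ord_prime_power[OF ac] .
    then have "n \<noteq> 0" using a1 ac ord_eq_1 by (cases "n = 0") auto
    then show ?thesis using that[of "n - 1"] n by (cases n) auto
  qed
  ultimately have "p * p ^ f dvd p * (t * u)"
    by (simp add: ac_simps)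
  then have "p ^ f dvd t * u"
    using prime_gt_0_nat[OF prime_p] by simp
  moreover have "coprime (p ^ f) u"
    using u(2) prime_p by (simp add: prime_imp_coprime)
  ultimately obtain j where "t = p ^ f * j"
    by (auto simp: coprime_dvd_mult_left_iff)
  moreover have "ord a div p = p ^ f" using f prime_gt_0_nat[OF prime_p] by simp
  ultimately have "a [^] t = (a [^] (ord a div p)) [^] j"
    using ac by (simp add: nat_pow_pow)
  then show ?thesis using t by metis
qed

text \<open>The subgroup \<open>C\<close>, generated by \<open>a\<close>, contains \<open>LCM_set G\<close>, so every element outside \<open>C\<close> must
fail both criteria for membership in \<open>LCM_set G\<close>. The first criterion, applied to
\<open>h\<close>, shows that \<open>a\<close> is no power of \<open>h\<close>. If \<open>1 + r + \<dots> + r ^ (p - 1)\<close> is \<open>p\<close>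
times a unit, \<open>h\<close> can therefore be corrected by a power of \<open>a\<close> to an element \<open>x\<close> with
\<open>x [^] p = \<one>\<close>, and \<open>x\<close> commutes with every element up to the central subgroup of order
\<open>p\<close> of \<open>C\<close>. The second criterion applies to \<open>x\<close> if \<open>p\<close> is odd; if \<open>p = 2\<close>, it applies
to the product of \<open>x\<close> and an element of order \<open>4\<close> in \<open>C\<close>. What remains is \<open>p = 2\<close> with
\<open>r\<close> equal to \<open>3\<close> modulo \<open>4\<close>, or \<open>C\<close> of order two.\<close>

lemma central_extension_of_LCM_cyclic:
  assumes C: "C \<lhd> G" and a: "a \<in> C" and C_cyclic: "\<And>x. x \<in> C \<Longrightarrow> \<exists>n::nat. x = a [^] n"
    and LCM: "LCM_set G \<subseteq> C"
    and h: "h \<in> carrier G" "h \<notin> C" and hp: "h [^] p \<in> C" and ha: "h \<otimes> a = a [^] (r::nat) \<otimes> h"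
    and comm: "\<And>g. g \<in> carrier G \<Longrightarrow> \<exists>c\<in>C. g \<otimes> h = c \<otimes> h \<otimes> g"
  shows "p = 2 \<and> (a [^] (2::nat) = \<one> \<or> [r = 3] (mod 4))" and "\<exists>j. h [^] p = a [^] (p * j)"
proof -
  interpret C: normal C G by fact
  have ac: "a \<in> carrier G" using a C.mem_carrier by blast
  have Cpow: "a [^] n \<in> C" for n :: nat using subgroup_nat_pow_closed[OF C.subgroup_axioms a] .
  have a_notin_h: "a \<noteq> h [^] m" for m :: nat
  proof
    assume am: "a = h [^] m"
    have "\<exists>r::nat. g \<otimes> h = h [^] r \<otimes> g" if g: "g \<in> carrier G" for g
    proof -
      obtain n :: nat where n: "g \<otimes> h = a [^] n \<otimes> h \<otimes> g" using comm[OF g] C_cyclic by blast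
      have "a [^] n \<otimes> h = h [^] (m * n + 1)"
        using h by (simp add: am nat_pow_pow)
      then show ?thesis using n by metis
    qed
    then have "h \<in> LCM_set G" using normal_cyclic_in_LCM_set h(1) by blast
    then show False using LCM h(2) by blast
  qed
  then have a1: "a \<noteq> \<one>" by (metis nat_pow_0)
  obtain s where s: "ord a = p ^ s" using ord_prime_power[OF ac] .
  have inverse_mod: "\<exists>w. [u * w = 1] (mod ord a)" if "\<not> p dvd u" for u
  proof -
    have "coprime u (ord a)"
      using that prime_p by (simp add: s coprime_commute prime_imp_coprime)
    then show ?thesis using cong_solve_coprime_nat by simp
  qed
  obtain i :: nat where i: "h [^] p = a [^] i" using C_cyclic[OF hp] by blast
  have "p dvd i"
  proof (rule ccontr)
    assume "\<not> p dvd i"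
    then obtain w where "[i * w = 1] (mod ord a)" using inverse_mod by blast
    then have "a [^] (i * w) = a [^] (1::nat)" using pow_eq_iff_cong[OF ac] by blast
    then have "a = h [^] (p * w)" using ac h by (simp add: i flip: nat_pow_pow)
    then show False using a_notin_h by blast
  qed
  then obtain j where j: "i = p * j" by blast
  then show "\<exists>j. h [^] p = a [^] (p * j)" using i by blast
  have r1: "[r = 1] (mod p)" using normalizes_exponent_cong_1[OF h(1) ac a1 ha] .
  have main: "p = 2 \<and> a [^] (2::nat) = \<one>" if odd: "odd p \<or> [r = 1] (mod 4)"
  proof -
    obtain u where u: "(\<Sum>i<p. r ^ i) = p * u" "\<not> p dvd u"
      using sum_powers_eq_prime_times_unit[OF prime_p r1 odd] .
    obtain w where w: "[u * w = 1] (mod ord a)" using inverse_mod u by blast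
    \<comment> \<open>\<open>v\<close> solves \<open>u * v + j = 0\<close> modulo the order of \<open>a\<close>; \<open>ord a - 1\<close> stands for \<open>-1\<close>.\<close>
    define v where "v = w * (j * (ord a - 1))"
    have ord_pos: "ord a > 0" using s prime_gt_0_nat[OF prime_p] by simp
    have "[u * w * (j * (ord a - 1)) + j = 1 * (j * (ord a - 1)) + j] (mod ord a)"
      using w by (intro cong_add cong_mult cong_refl)
    moreover have "1 * (j * (ord a - 1)) + j = ord a * j"
      using ord_pos by (cases "ord a") (auto simp: algebra_simps)
    ultimately have v: "ord a dvd u * v + j"
      unfolding v_def by (metis cong_0_iff cong_mult_self_left cong_trans mult.assoc)
    define x where "x = a [^] v \<otimes> h"
    have x: "x \<in> carrier G" using ac h by (simp add: x_def)
    have "x [^] p = (a [^] v) [^] (p * u) \<otimes> h [^] p"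
      unfolding x_def u(1)[symmetric]
      using ac h normalizes_pow[OF h(1) ac ha] by (intro mult_pow_normalizes) auto
    also have "\<dots> = a [^] (p * (u * v + j))"
      using ac by (simp add: i j nat_pow_pow nat_pow_mult algebra_simps)
    finally have xp: "x [^] p = \<one>"
      using v ac by (simp add: pow_eq_id)
    have xC: "x \<notin> C"
    proof
      assume "x \<in> C"
      then have "inv (a [^] v) \<otimes> x \<in> C" using Cpow by blast
      then show False using h ac by (simp add: x_def flip: m_assoc)
    qed
    have xa: "x \<otimes> a = a [^] r \<otimes> x"
      using ac h by (simp add: x_def m_assoc ha) (simp add: nat_pow_mult add.commute flip: m_assoc)
    have xcomm: "\<exists>c\<in>C. g \<otimes> x = c \<otimes> x \<otimes> g" if g: "g \<in> carrier G" for g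
    proof -
      obtain c where c: "c \<in> C" "g \<otimes> h = c \<otimes> h \<otimes> g" using comm[OF g] by blast
      obtain d where d: "d \<in> C" "g \<otimes> a [^] v = d \<otimes> g" using normal_conj_mult[OF C Cpow g] .
      have cd: "c \<in> carrier G" "d \<in> carrier G" using c d C.mem_carrier by auto
      have "g \<otimes> x = (g \<otimes> a [^] v) \<otimes> h" using g h ac by (simp add: x_def m_assoc)
      also have "\<dots> = d \<otimes> c \<otimes> h \<otimes> g" using g h cd d by (simp add: m_assoc c)
      also have "\<dots> = d \<otimes> c \<otimes> inv (a [^] v) \<otimes> x \<otimes> g"
        using g h cd ac inv_solve_left'[of h "a [^] v" x] by (simp add: x_def m_assoc)
      finally show ?thesis using c d Cpow by blast
    qed
    define z where "z = a [^] (ord a div p)"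
    have zc: "z \<in> carrier G" using ac by (simp add: z_def)
    have "p dvd ord a" using prime_dvd_ord[OF ac a1] .
    then have zp: "z [^] p = \<one>" using ac by (simp add: z_def nat_pow_pow)
    have norm: "\<exists>r::nat. g \<otimes> a = a [^] r \<otimes> g" if "g \<in> carrier G" for g
      using normal_conj_mult[OF C a that] C_cyclic by metis
    have z_central: "z \<otimes> g = g \<otimes> z" if g: "g \<in> carrier G" for g
    proof -
      obtain r :: nat where "g \<otimes> a = a [^] r \<otimes> g" using norm[OF g] by blast
      then have "g \<otimes> z = z [^] r \<otimes> g" unfolding z_def by (rule normalizes_pow[OF g ac])
      then show ?thesis using normal_order_p_central[OF g zc zp] by simp
    qed
    have z_pow: "z [^] k \<otimes> g = g \<otimes> z [^] k" if "g \<in> carrier G" for g and k :: nat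
      by (rule group_commutes_pow[OF z_central[OF that] zc that])
    have z_comm: "\<exists>j::nat. g \<otimes> x = z [^] j \<otimes> x \<otimes> g" if g: "g \<in> carrier G" for g
      unfolding z_def
      by (rule order_p_complement_commutators[OF C a C_cyclic x xp xa xcomm a1 u g])
    show ?thesis
    proof (cases "odd p")
      case True
      then have "x \<in> LCM_set G"
        using central_commutator_in_LCM_set[OF x zc zp z_central z_comm] by blast
      then show ?thesis using LCM xC by blast
    next
      case False
      then have p2: "p = 2" using primes_dvd_imp_eq[OF two_is_prime_nat prime_p] by simp
      have "a [^] (2::nat) = \<one>"
      proof (rule ccontr)
        assume a2: "a [^] (2::nat) \<noteq> \<one>"
        have "\<not> 2 ^ s dvd (2 :: nat)" using a2 ac s p2 by (simp add: pow_eq_id)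
        then have "2 \<le> s" by (cases "s = 0 \<or> s = 1") auto
        then have "4 dvd ord a" using le_imp_power_dvd[of 2 s "2::nat"] by (simp add: s p2)
        then obtain m where m: "ord a = 4 * m" by blast
        define q where "q = a [^] m"
        have qc: "q \<in> carrier G" using ac by (simp add: q_def)
        have q2: "q [^] (2::nat) = z" using ac m by (simp add: q_def z_def nat_pow_pow p2 mult.commute)
        have z1: "z \<noteq> \<one>" using ord_pos ac m by (auto simp: z_def pow_eq_id p2 dest: dvd_imp_le)
        have "q [^] (4::nat) = \<one>" using ac m by (simp add: q_def nat_pow_pow pow_eq_id)
        then have "ord q dvd 4" using qc by (simp add: pow_eq_id)
        then have "[r = 1] (mod ord q)" using odd False cong_dvd_modulus_nat by blast
        then have "q [^] r = q" using pow_eq_iff_cong[OF qc, of r 1] qc by simp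
        then have xq: "x \<otimes> q = q \<otimes> x" using normalizes_pow[OF x ac xa, of m] by (simp add: q_def)
        \<comment> \<open>An element of order \<open>4\<close> whose commutators are still powers of \<open>z\<close>, because \<open>q\<close> is conjugate only to \<open>q\<close> and \<open>z \<otimes> q\<close>.\<close>
        define y where "y = q \<otimes> x"
        have yc: "y \<in> carrier G" using qc x by (simp add: y_def)
        have "y [^] (2::nat) = z"
          unfolding y_def using pow_mult_distrib[of q x 2] xq xp qc x by (simp add: q2 p2 zc)
        then have "\<not> ord y dvd 2" using z1 yc by (simp flip: pow_eq_id)
        moreover obtain f where f: "ord y = 2 ^ f" using ord_prime_power[OF yc] p2 by blast
        ultimately have "2 \<le> f" by (cases "f = 0 \<or> f = 1") auto
        then have "4 dvd ord y" using le_imp_power_dvd[of 2 f "2::nat"] by (simp add: f)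
        moreover have "\<exists>j::nat. g \<otimes> y = z [^] j \<otimes> y \<otimes> g" if g: "g \<in> carrier G" for g
        proof -
          obtain \<rho> :: nat where \<rho>: "g \<otimes> a = a [^] \<rho> \<otimes> g" using norm[OF g] by blast
          have "[\<rho> = 1] (mod 2)" using normalizes_exponent_cong_1[OF g ac a1 \<rho>] p2 by simp
          then have "odd \<rho>" by (simp add: cong_def odd_iff_mod_2_eq_one)
          then obtain k where k: "\<rho> = 2 * k + 1" by (auto elim: oddE)
          have "g \<otimes> q = q [^] \<rho> \<otimes> g" unfolding q_def using normalizes_pow[OF g ac \<rho>] .
          moreover have "q [^] \<rho> = z [^] k \<otimes> q" using qc by (simp add: k nat_pow_pow flip: q2)
          ultimately have gq: "g \<otimes> q = z [^] k \<otimes> q \<otimes> g" by simp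
          obtain j :: nat where j: "g \<otimes> x = z [^] j \<otimes> x \<otimes> g" using z_comm[OF g] by blast
          have "g \<otimes> y = z [^] k \<otimes> q \<otimes> (g \<otimes> x)"
            using gq g qc x zc by (simp add: y_def flip: m_assoc)
          also have "\<dots> = z [^] k \<otimes> (q \<otimes> z [^] j) \<otimes> x \<otimes> g"
            using g qc x zc by (simp add: j m_assoc)
          also have "\<dots> = z [^] (k + j) \<otimes> y \<otimes> g"
            using g qc x zc by (simp add: z_pow[OF qc, symmetric] y_def m_assoc flip: nat_pow_mult)
          finally show ?thesis by blast
        qed
        ultimately have "y \<in> LCM_set G"
          using central_commutator_in_LCM_set[OF yc zc zp z_central] by blast
        then have "inv (a [^] m) \<otimes> y \<in> C" using LCM Cpow by blast
        then show False using xC x qc by (simp add: y_def flip: q_def m_assoc)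
      qed
      then show ?thesis using p2 by simp
    qed
  qed
  show "p = 2 \<and> (a [^] (2::nat) = \<one> \<or> [r = 3] (mod 4))"
  proof (cases "odd p \<or> [r = 1] (mod 4)")
    case False
    then have "p = 2" using primes_dvd_imp_eq[OF two_is_prime_nat prime_p] by simp
    moreover have "r mod 4 = 3" using False r1 \<open>p = 2\<close> unfolding cong_def by simp presburger
    ultimately show ?thesis by (simp add: cong_def)
  qed (use main in simp)
qed

end

section \<open>The models of maximal class\<close>

text \<open>The relations determine the multiplication of the normal forms \<open>a [^] i\<close> and
\<open>a [^] i \<otimes> b\<close>.\<close>

lemma (in group) iso_cyclic_by_two:
  fixes r s :: int
  assumes model: "group (cyclic_by_two N r s)" and N: "N > 0"
    and a: "a \<in> carrier G" and b: "b \<in> carrier G" and ord_a: "ord a = N"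
    and ba: "b \<otimes> a = a [^] r \<otimes> b" and bb: "b \<otimes> b = a [^] s"
    and cover: "\<And>x. x \<in> carrier G \<Longrightarrow> \<exists>i::nat. x = a [^] i \<or> x = a [^] i \<otimes> b"
    and b_notin: "\<And>i::nat. b \<noteq> a [^] i"
  shows "G \<cong> cyclic_by_two N r s"
proof -
  let ?H = "cyclic_by_two N r s"
  define f where "f = (\<lambda>(i::int, j::nat). a [^] i \<otimes> b [^] j)"
  have mod_N: "a [^] (i mod int N) = a [^] i" for i :: int
    using a by (simp add: int_pow_eq ord_a minus_mod_eq_mult_div)
  have b_notin_int: "b \<noteq> a [^] i" for i :: int
    using mod_N[of i] N b_notin[of "nat (i mod int N)"] by (simp add: pow_nat)
  have b_pow: "b \<otimes> a [^] k = a [^] (r * k) \<otimes> b" if "k \<ge> 0" for k :: int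
  proof -
    have "b \<otimes> a [^] int m = a [^] (r * int m) \<otimes> b" for m
    proof (induction m)
      case (Suc m)
      have m: "int (Suc m) = int m + 1" by simp
      have "b \<otimes> a [^] int (Suc m) = (b \<otimes> a [^] int m) \<otimes> a"
        unfolding m int_pow_mult[OF a] using a b by (simp add: m_assoc)
      also have "\<dots> = a [^] (r * int m) \<otimes> (b \<otimes> a)"
        unfolding Suc using a b by (simp add: m_assoc)
      also have "\<dots> = a [^] (r * int m) \<otimes> a [^] r \<otimes> b"
        unfolding ba using a b by (simp add: m_assoc)
      also have "a [^] (r * int m) \<otimes> a [^] r = a [^] (r * int (Suc m))"
        using a by (simp add: int_pow_mult[symmetric] distrib_left add.commute)
      finally show ?case .
    qed (use b in simp)
    then show ?thesis using that by (metis nonneg_int_cases)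
  qed
  have f0: "f (i, 0) = a [^] i" and f1: "f (i, Suc 0) = a [^] i \<otimes> b" for i
    using a b by (simp_all add: f_def)
  have hom: "f \<in> hom ?H G"
  proof (rule homI)
    fix x assume "x \<in> carrier ?H"
    then show "f x \<in> carrier G" using a b by (cases x) (auto simp: f_def)
  next
    fix x y assume "x \<in> carrier ?H" "y \<in> carrier ?H"
    then obtain i j k l where xy: "x = (i, j)" "y = (k, l)" "j = 0 \<or> j = 1" "l = 0 \<or> l = 1" "k \<ge> 0"
      by (auto simp: cyclic_by_two_def)
    have m: "x \<otimes>\<^bsub>?H\<^esub> y = ((i + r ^ j * k + s * int ((j + l) div 2)) mod int N, (j + l) mod 2)"
      by (simp add: xy cyclic_by_two_def)
    consider "j = 0" | "j = 1" "l = 0" | "j = 1" "l = 1" using xy by blast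
    then show "f (x \<otimes>\<^bsub>?H\<^esub> y) = f x \<otimes> f y"
    proof cases
      case 1
      then show ?thesis unfolding m using xy(4) a b
        by (auto simp: xy(1,2) f0 f1 mod_N int_pow_mult m_assoc)
    next
      case 2
      have "f x \<otimes> f y = a [^] i \<otimes> (b \<otimes> a [^] k)"
        using a b by (simp add: xy(1,2) 2 f0 f1 m_assoc)
      also have "\<dots> = a [^] (i + r * k) \<otimes> b"
        using a b xy(5) by (simp add: b_pow int_pow_mult m_assoc)
      finally show ?thesis
        unfolding m by (simp add: 2 f1 mod_N)
    next
      case 3
      have "f x \<otimes> f y = a [^] i \<otimes> (b \<otimes> a [^] k) \<otimes> b"
        using a b by (simp add: xy(1,2) 3 f1 m_assoc)
      also have "\<dots> = a [^] (i + r * k) \<otimes> (b \<otimes> b)"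
        using a b xy(5) by (simp add: b_pow int_pow_mult m_assoc)
      also have "\<dots> = a [^] (i + r * k + s)"
        using a by (simp add: bb int_pow_mult)
      finally show ?thesis
        unfolding m by (simp add: 3 f0 mod_N)
    qed
  qed
  have inj: "inj_on f (carrier ?H)"
  proof (rule inj_onI)
    fix x y assume "x \<in> carrier ?H" "y \<in> carrier ?H" and eq: "f x = f y"
    then obtain i j k l where xy: "x = (i, j)" "y = (k, l)" "j = 0 \<or> j = 1" "l = 0 \<or> l = 1"
      and ik: "0 \<le> i" "i < int N" "0 \<le> k" "k < int N"
      by (auto simp: cyclic_by_two_def)
    have same: "i = k" if "a [^] i = a [^] k"
    proof -
      have "int N dvd k - i" using that a by (simp add: int_pow_eq ord_a)
      then have "k mod int N = i mod int N" by (simp add: mod_eq_dvd_iff)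
      then show ?thesis using ik by simp
    qed
    have differ: "a [^] m \<noteq> a [^] n \<otimes> b" for m n :: int
    proof
      assume "a [^] m = a [^] n \<otimes> b"
      then have "b = inv (a [^] n) \<otimes> a [^] m" using a b by (simp flip: m_assoc)
      then have "b = a [^] (- n + m)" using a by (simp only: int_pow_mult int_pow_neg)
      then show False using b_notin_int by blast
    qed
    consider "j = l" | "j = 0" "l = 1" | "j = 1" "l = 0" using xy by blast
    then show "x = y"
    proof cases
      case 1
      then have "a [^] i = a [^] k" using eq a b by (simp add: xy(1,2) f_def)
      then show ?thesis using same 1 xy by simp
    next
      case 2
      then show ?thesis using eq differ[of i k] by (simp add: xy(1,2) f0 f1)
    next
      case 3
      then show ?thesis using eq differ[of k i] by (simp add: xy(1,2) f0 f1)
    qed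
  qed
  have "x \<in> f ` carrier ?H" if x: "x \<in> carrier G" for x
  proof -
    obtain i :: nat where i: "x = a [^] i \<or> x = a [^] i \<otimes> b" using cover[OF x] by blast
    define k where "k = int i mod int N"
    have "a [^] k = a [^] i" by (simp add: k_def mod_N int_pow_int)
    then have "x = f (k, 0) \<or> x = f (k, 1)" using i by (simp add: f0 f1)
    moreover have "(k, 0) \<in> carrier ?H" "(k, 1) \<in> carrier ?H"
      using N by (auto simp: cyclic_by_two_def k_def)
    ultimately show ?thesis by blast
  qed
  then have "f ` carrier ?H = carrier G"
    using hom by (auto simp: hom_def)
  then have "f \<in> iso ?H G"
    using hom inj by (simp add: iso_def bij_betw_def)
  then have "?H \<cong> G" by (rule is_isoI)
  then show ?thesis by (rule group.iso_sym[OF model])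
qed

text \<open>Let \<open>2 ^ s\<close> be the order of \<open>a\<close>. Since \<open>b\<^sup>2\<close> is a power of \<open>a\<close>, it commutes with \<open>a\<close> and
with \<open>b\<close>; this gives \<open>r\<^sup>2 = 1\<close> modulo \<open>2 ^ s\<close> and \<open>b\<^sup>2 = \<one>\<close> or
\<open>b\<^sup>2 = a [^] 2 ^ (s - 1)\<close>. As \<open>r\<close> is \<open>3\<close> modulo \<open>4\<close>, it is \<open>-1\<close> or
\<open>2 ^ (s - 1) - 1\<close>. In the second case \<open>b\<close> or \<open>a \<otimes> b\<close> is an involution. The
quaternion group of order \<open>8\<close> is excluded because there \<open>b\<close> also generates a normal
subgroup.\<close>

lemma (in prime_exponent_group) maximal_class_2_group:
  assumes p2: "p = 2" and a: "a \<in> carrier G" and b: "b \<in> carrier G"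
    and ba: "b \<otimes> a = a [^] (r::nat) \<otimes> b" and r: "[r = 3] (mod 4)"
    and a2: "a [^] (2::nat) \<noteq> \<one>" and bb: "b [^] (2::nat) = a [^] (2 * j :: nat)"
    and cover: "\<And>x. x \<in> carrier G \<Longrightarrow> \<exists>i::nat. x = a [^] i \<or> x = a [^] i \<otimes> b"
    and b_notin: "\<And>i::nat. b \<noteq> a [^] i" and b_LCM: "b \<notin> LCM_set G"
  shows "(\<exists>n\<ge>3. G \<cong> dihedral_2group n) \<or> (\<exists>n\<ge>4. G \<cong> semidihedral_2group n) \<or>
    (\<exists>n\<ge>4. G \<cong> quaternion_2group n)"
proof -
  obtain s where s: "ord a = 2 ^ s" using ord_prime_power[OF a] p2 by blast
  have "\<not> 2 ^ s dvd (2 :: nat)" using a2 a s by (simp add: pow_eq_id)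
  then have s2: "2 \<le> s" by (cases "s = 0 \<or> s = 1") auto
  then obtain q where q: "s = Suc (Suc q)" by (metis add_2_eq_Suc le_Suc_ex)
  have pow_eq: "a [^] m = a [^] n \<longleftrightarrow> 2 ^ s dvd n - m" for m n :: int
    using int_pow_eq[OF a, of m n] by (simp add: s)
  obtain k where k: "r = 4 * k + 3"
    using r by (metis cong_def mod_less numeral_less_iff semiring_norm(76) semiring_norm(81) mult_div_mod_eq)
  have bb': "b \<otimes> b = a [^] int (2 * j)"
  proof -
    have "b \<otimes> b = b [^] (2::nat)" using b by (simp add: numeral_2_eq_2)
    then show ?thesis by (simp only: bb int_pow_int)
  qed
  have "a [^] (2 * j) \<otimes> a = a [^] (r ^ 2) \<otimes> a [^] (2 * j)"
    using pow_normalizes[OF b a ba, of 2] by (simp only: bb)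
  then have "a [^] (2 * j + 1) = a [^] (r ^ 2 + 2 * j)"
    using a by (simp add: nat_pow_mult)
  then have "a [^] int (2 * j + 1) = a [^] int (r ^ 2 + 2 * j)"
    by (simp only: int_pow_int)
  then have "(2::int) ^ s dvd int (r ^ 2 + 2 * j) - int (2 * j + 1)"
    by (simp only: pow_eq)
  also have "int (r ^ 2 + 2 * j) - int (2 * j + 1) = 4 * (2 * (int k + 1) * (2 * int k + 1))"
    by (simp add: k power2_eq_square algebra_simps)
  finally have "(2::int) ^ q dvd 2 * (int k + 1) * (2 * int k + 1)"
    by (simp add: q)
  moreover have "coprime ((2::int) ^ q) (2 * int k + 1)" by simp
  ultimately have "(2::int) ^ q dvd 2 * (int k + 1)"
    by (simp only: coprime_dvd_mult_left_iff)
  then obtain w where w: "2 * (int k + 1) = 2 ^ q * w" by blast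
  \<comment> \<open>The parity of \<open>w\<close> decides between \<open>r = -1\<close> and \<open>r = 2 ^ (s - 1) - 1\<close>.\<close>
  have r_eq: "int r = 2 ^ Suc q * w - 1" using w by (simp add: k)
  have "b \<otimes> b [^] (2::nat) = (a [^] (2 * j)) [^] r \<otimes> b"
    unfolding bb by (rule normalizes_pow[OF b a ba])
  moreover have "b \<otimes> b [^] (2::nat) = b [^] (2::nat) \<otimes> b"
    using b by (simp add: numeral_2_eq_2 m_assoc)
  ultimately have "a [^] (2 * j) = a [^] (2 * j * r)"
    using a b by (simp add: bb nat_pow_pow)
  then have "a [^] int (2 * j) = a [^] int (2 * j * r)"
    by (simp only: int_pow_int)
  then have "(2::int) ^ s dvd int (2 * j * r) - int (2 * j)"
    by (simp only: pow_eq)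
  also have "int (2 * j * r) - int (2 * j) = 4 * (int j * (2 * int k + 1))"
    by (simp add: k algebra_simps)
  finally have "(2::int) ^ q dvd int j * (2 * int k + 1)"
    by (simp add: q)
  moreover have "coprime ((2::int) ^ q) (2 * int k + 1)" by simp
  ultimately have "(2::int) ^ q dvd int j"
    by (simp only: coprime_dvd_mult_left_iff)
  then obtain v where v: "int j = 2 ^ q * v" by blast
  have ba': "b \<otimes> a = a [^] int r \<otimes> b" using ba by (simp add: int_pow_int)
  define N :: nat where "N = 2 ^ s"
  have N: "N > 0" "ord a = N" by (simp_all add: N_def s)
  note iso = iso_cyclic_by_two[OF _ N(1) a _ N(2)]
  \<comment> \<open>The parity of \<open>v\<close> decides whether \<open>b\<close> is an involution.\<close>
  have bb_even: "b \<otimes> b = a [^] (0::int)" if "even v"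
    using that v unfolding bb' by (simp only: pow_eq) (auto simp: q)
  have bb_odd: "b \<otimes> b = a [^] ((2::int) ^ Suc q)" if v_odd: "odd v"
  proof -
    obtain v' where "v = 2 * v' + 1" using v_odd by (auto elim: oddE)
    then have "(2::int) ^ Suc q - int (2 * j) = 2 ^ s * (- v')" using v by (simp add: q algebra_simps)
    then show ?thesis unfolding bb' pow_eq by simp
  qed
  show ?thesis
  proof (cases "even w")
    case True
    then have ba_inv: "b \<otimes> a = a [^] (-1::int) \<otimes> b"
      unfolding ba' using r_eq pow_eq[of "int r" "-1"] by (auto simp: q elim!: evenE)
    show ?thesis
    proof (cases "even v")
      case True
      have "G \<cong> dihedral_2group (Suc s)"
        unfolding dihedral_2group_def
        using iso[OF _ b ba_inv bb_even[OF True] cover b_notin] group_dihedral_2group[of "Suc s"]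
        by (simp add: dihedral_2group_def N_def)
      then show ?thesis using s2 by (intro disjI1 exI[of _ "Suc s"]) simp
    next
      case False
      have "s \<noteq> 2"
      proof
        assume "s = 2"
        then have [simp]: "q = 0" by (simp add: q)
        have z: "b \<otimes> b = a [^] (2::int)" using bb_odd[OF False] by simp
        have "a \<otimes> b = a [^] (2::int) \<otimes> (a [^] (-1::int) \<otimes> b)"
          using a b by (simp add: int_pow_mult[symmetric] flip: m_assoc)
        also have "\<dots> = b \<otimes> b \<otimes> (b \<otimes> a)"
          using ba_inv z by simp
        also have "\<dots> = b [^] (3::nat) \<otimes> a"
          using a b by (simp add: numeral_3_eq_3 m_assoc)
        finally have ab: "a [^] i \<otimes> b = b [^] (3 ^ i :: nat) \<otimes> a [^] i" for i :: nat
          using pow_normalizes[OF a b] by blast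
        have "\<exists>m::nat. g \<otimes> b = b [^] m \<otimes> g" if g: "g \<in> carrier G" for g
        proof -
          obtain i :: nat where "g = a [^] i \<or> g = a [^] i \<otimes> b" using cover[OF g] by blast
          then have "g \<otimes> b = b [^] (3 ^ i :: nat) \<otimes> g"
          proof
            assume gi: "g = a [^] i \<otimes> b"
            have "g \<otimes> b = (b [^] (3 ^ i :: nat) \<otimes> a [^] i) \<otimes> b"
              by (simp only: gi ab)
            then show ?thesis using a b by (simp add: gi m_assoc)
          qed (simp only: ab)
          then show ?thesis ..
        qed
        then have "b \<in> LCM_set G" using normal_cyclic_in_LCM_set b by blast
        then show False using b_LCM by simp
      qed
      have "G \<cong> quaternion_2group (Suc s)"
        unfolding quaternion_2group_def
        using iso[OF _ b ba_inv bb_odd[OF False] cover b_notin] group_quaternion_2group[of "Suc s"] s2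
        by (simp add: quaternion_2group_def N_def q)
      then show ?thesis using s2 \<open>s \<noteq> 2\<close> by (intro disjI2 exI[of _ "Suc s"]) simp
    qed
  next
    case False
    then obtain w' where w': "w = 2 * w' + 1" by (auto elim: oddE)
    \<comment> \<open>An odd \<open>w\<close> makes \<open>2 * (k + 1)\<close> odd if \<open>q = 0\<close>, which is absurd.\<close>
    have "q \<noteq> 0" using w w' by (cases q) (auto, presburger)
    then have s3: "s \<ge> 3" by (simp add: q)
    have "(2::int) ^ Suc q - 1 - int r = 2 ^ s * (- w')"
      using w' by (simp add: r_eq q algebra_simps)
    then have ba_semi: "c \<otimes> a = a [^] ((2::int) ^ Suc q - 1) \<otimes> c" if "c = b \<or> c = a \<otimes> b" for c
    proof -
      assume "(2::int) ^ Suc q - 1 - int r = 2 ^ s * (- w')"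
      then have "a [^] int r = a [^] ((2::int) ^ Suc q - 1)" unfolding pow_eq by simp
      then have *: "b \<otimes> a = a [^] ((2::int) ^ Suc q - 1) \<otimes> b" using ba' by simp
      moreover have "a \<otimes> b \<otimes> a = a [^] ((2::int) ^ Suc q - 1) \<otimes> (a \<otimes> b)"
      proof -
        have "a \<otimes> b \<otimes> a = a [^] (1 + ((2::int) ^ Suc q - 1)) \<otimes> b"
          unfolding int_pow_mult[OF a] using a b * by (simp add: m_assoc)
        also have "\<dots> = a [^] (((2::int) ^ Suc q - 1) + 1) \<otimes> b"
          by (simp only: add.commute)
        finally show ?thesis
          unfolding int_pow_mult[OF a] using a b by (simp add: m_assoc)
      qed
      ultimately show ?thesis using that by blast
    qed
    obtain c where c: "c = b \<or> c = a \<otimes> b" "c \<otimes> c = a [^] (0::int)"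
    proof (cases "even v")
      case True
      then show ?thesis using that bb_even by blast
    next
      case False
      have "a \<otimes> b \<otimes> (a \<otimes> b) = a \<otimes> (b \<otimes> a) \<otimes> b"
        using a b by (simp add: m_assoc)
      also have "\<dots> = a [^] (1::int) \<otimes> a [^] ((2::int) ^ Suc q - 1) \<otimes> (b \<otimes> b)"
        using a b by (simp only: ba_semi[of b] simp_thms) (simp add: m_assoc)
      also have "\<dots> = a [^] ((1::int) + (2 ^ Suc q - 1) + 2 ^ Suc q)"
        unfolding bb_odd[OF False] by (simp only: int_pow_mult[OF a])
      also have "\<dots> = a [^] (0::int)"
        unfolding pow_eq by (simp add: q)
      finally show ?thesis using that by blast
    qed
    have cc: "c \<in> carrier G" using c a b by auto
    have a_inv: "a [^] (N - 1) \<otimes> a = \<one>"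
      using N pow_ord_eq_1[OF a] nat_pow_Suc[of a "N - 1"] by (simp del: nat_pow_Suc)
    have c_cover: "\<exists>i::nat. x = a [^] i \<or> x = a [^] i \<otimes> c" if x: "x \<in> carrier G" for x
    proof (cases "c = b")
      case False
      then have "c = a \<otimes> b" using c by simp
      obtain i :: nat where i: "x = a [^] i \<or> x = a [^] i \<otimes> b" using cover[OF x] by blast
      have "a [^] (i + (N - 1)) \<otimes> c = a [^] i \<otimes> (a [^] (N - 1) \<otimes> a) \<otimes> b"
        unfolding \<open>c = a \<otimes> b\<close> nat_pow_mult[OF a, symmetric] using a b by (simp add: m_assoc)
      also have "\<dots> = a [^] i \<otimes> b"
        unfolding a_inv using a b by simp
      finally show ?thesis using i by metis
    qed (use cover x in blast)
    have c_notin: "c \<noteq> a [^] (i::nat)" for i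
    proof
      assume "c = a [^] i"
      then consider "b = a [^] i" | "a \<otimes> b = a [^] i" using c by metis
      then show False
      proof cases
        case 2
        have "b = a [^] (N - 1) \<otimes> (a \<otimes> b)"
          using a b a_inv m_assoc[of "a [^] (N - 1)" a b] by simp
        then have "b = a [^] (N - 1 + i)" using a 2 by (simp add: nat_pow_mult)
        then show False using b_notin by blast
      qed (use b_notin in blast)
    qed
    have "G \<cong> semidihedral_2group (Suc s)"
      unfolding semidihedral_2group_def
      using iso[OF _ cc ba_semi[OF c(1)] c(2) c_cover c_notin] group_semidihedral_2group[of "Suc s"] s3
      by (simp add: semidihedral_2group_def N_def q)
    then show ?thesis using s3 by (intro disjI2 disjI1 exI[of _ "Suc s"]) simp
  qed
qed

lemma (in group) iso_cyclic_by_twoD: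
  fixes r s :: int
  assumes iso: "G \<cong> cyclic_by_two N r s" and model: "group (cyclic_by_two N r s)" and N: "N > 0"
  obtains a b and \<rho> :: nat where "a \<in> carrier G" "b \<in> carrier G" "b \<otimes> a = a [^] \<rho> \<otimes> b"
    "\<And>x. x \<in> carrier G \<Longrightarrow> \<exists>i::nat. x = a [^] i \<or> x = a [^] i \<otimes> b"
proof -
  let ?H = "cyclic_by_two N r s"
  interpret H: group ?H by fact
  obtain \<phi> where \<phi>: "\<phi> \<in> iso ?H G"
    using iso_sym[OF iso] by (auto simp: is_iso_def)
  interpret \<phi>: group_hom ?H G \<phi>
    using \<phi> by unfold_locales (simp add: iso_def)
  define a b where "a = (1 mod int N, 0::nat)" and "b = (0::int, 1::nat)"
  have ab: "a \<in> carrier ?H" "b \<in> carrier ?H"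
    using N by (auto simp: a_def b_def cyclic_by_two_def)
  have a_pow: "a [^]\<^bsub>?H\<^esub> k = (int k mod int N, 0)" for k :: nat
    by (induction k) (auto simp: a_def cyclic_by_two_def mod_simps add.commute)
  have "b \<otimes>\<^bsub>?H\<^esub> a = a [^]\<^bsub>?H\<^esub> (nat (r mod int N)) \<otimes>\<^bsub>?H\<^esub> b"
    using N unfolding a_pow by (simp add: a_def b_def cyclic_by_two_def mod_simps)
  then have "\<phi> b \<otimes> \<phi> a = \<phi> a [^] (nat (r mod int N)) \<otimes> \<phi> b"
    using ab by (metis \<phi>.hom_mult \<phi>.hom_nat_pow H.nat_pow_closed)
  moreover have "\<exists>i::nat. x = \<phi> a [^] i \<or> x = \<phi> a [^] i \<otimes> \<phi> b" if x: "x \<in> carrier G" for x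
  proof -
    have "x \<in> \<phi> ` carrier ?H"
      using \<phi> x by (simp add: iso_def bij_betw_def)
    then obtain y where y: "y \<in> carrier ?H" "x = \<phi> y" by blast
    then obtain i j where ij: "y = (i, j)" "0 \<le> i" "i < int N" "j = 0 \<or> j = 1"
      by (auto simp: cyclic_by_two_def)
    then have "y = a [^]\<^bsub>?H\<^esub> (nat i) \<or> y = a [^]\<^bsub>?H\<^esub> (nat i) \<otimes>\<^bsub>?H\<^esub> b"
      unfolding a_pow by (auto simp: b_def cyclic_by_two_def)
    then show ?thesis
      using y(2) ab by (metis \<phi>.hom_mult \<phi>.hom_nat_pow H.nat_pow_closed)
  qed
  ultimately show ?thesis
    using that ab \<phi>.hom_closed by blast
qed

section \<open>Series with cyclic factors\<close>

text \<open>The subgroup generated by \<open>a\<close> is normal, so it is contained in \<open>LC G\<close>. Its index is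
at most two, and \<open>LC G\<close> is proper.\<close>

lemma (in prime_exponent_group) maximal_class_LC_series:
  assumes a: "a \<in> carrier G" and b: "b \<in> carrier G" and ba: "b \<otimes> a = a [^] (\<rho>::nat) \<otimes> b"
    and cover: "\<And>x. x \<in> carrier G \<Longrightarrow> \<exists>i::nat. x = a [^] i \<or> x = a [^] i \<otimes> b"
    and top: "LC_series G 2 = carrier G" and proper: "LC_series G 1 \<noteq> carrier G"
    and "i \<le> 1"
  shows "cyclic_group (LC_factor G i)"
proof -
  have LC: "subgroup (LC G) G" using LC_normal normal_imp_subgroup by blast
  have "\<exists>m::nat. g \<otimes> a = a [^] m \<otimes> g" if g: "g \<in> carrier G" for g
  proof -
    obtain i :: nat where "g = a [^] i \<or> g = a [^] i \<otimes> b" using cover[OF g] by blast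
    then show ?thesis
    proof
      assume "g = a [^] i"
      then have "g \<otimes> a = a [^] (1::nat) \<otimes> g"
        using a nat_pow_Suc2[OF a, of i] by simp
      then show ?thesis ..
    next
      assume gi: "g = a [^] i \<otimes> b"
      then have "g \<otimes> a = a [^] i \<otimes> a [^] \<rho> \<otimes> b"
        using a b by (simp add: m_assoc ba)
      also have "\<dots> = a [^] \<rho> \<otimes> g"
        using a b by (simp add: gi nat_pow_comm[of a i \<rho>] flip: m_assoc)
      finally show ?thesis ..
    qed
  qed
  then have "a \<in> LCM_set G" using normal_cyclic_in_LCM_set a by blast
  then have "a \<in> LC G" by (simp add: LC_def generate.incl)
  then have a_LC: "a [^] m \<in> LC G" for m :: nat
    using subgroup_nat_pow_closed[OF LC] by blast
  have LC_cyclic: "\<exists>m::nat. x = a [^] m" if x: "x \<in> LC G" for x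
  proof (rule ccontr)
    assume no: "\<nexists>m::nat. x = a [^] m"
    have xc: "x \<in> carrier G" using x subgroup.mem_carrier[OF LC] by blast
    obtain m :: nat where "x = a [^] m \<otimes> b" using cover[OF xc] no by blast
    then have "b = inv (a [^] m) \<otimes> x" using a b by (simp flip: m_assoc)
    then have "b \<in> LC G" using a_LC x subgroup.m_closed[OF LC] subgroup.m_inv_closed[OF LC] by blast
    then have "carrier G \<subseteq> LC G" using cover a_LC subgroup.m_closed[OF LC] by blast
    then show False using proper subgroup.subset[OF LC] by auto
  qed
  consider "i = 0" | "i = 1" using \<open>i \<le> 1\<close> by linarith
  then show ?thesis
  proof cases
    case 1
    have "\<exists>n::int. \<exists>c\<in>{\<one>}. x = c \<otimes> a [^] n" if "x \<in> LC G" for x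
      using LC_cyclic[OF that] a by (metis int_pow_int int_pow_closed insertI1 l_one)
    then have "cyclic_group (G\<lparr>carrier := LC G\<rparr> Mod {\<one>})"
      using cyclic_factor_iff[OF one_is_normal LC] subgroup.one_closed[OF LC] \<open>a \<in> LC G\<close> by auto
    then show ?thesis using 1 by (simp add: LC_factor_def)
  next
    case 2
    have "\<exists>n::int. \<exists>c\<in>LC G. x = c \<otimes> b [^] n" if x: "x \<in> carrier G" for x
    proof -
      obtain m :: nat where "x = a [^] m \<or> x = a [^] m \<otimes> b" using cover[OF x] by blast
      then have "x = a [^] m \<otimes> b [^] (0::int) \<or> x = a [^] m \<otimes> b [^] (1::int)"
        using a b by simp
      then show ?thesis using a_LC by blast
    qed
    then have "cyclic_group (G\<lparr>carrier := carrier G\<rparr> Mod LC G)"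
      using cyclic_factor_iff[OF LC_normal subgroup_self subgroup.subset[OF LC]] b by blast
    then show ?thesis using 2 top by (simp add: LC_factor_def numeral_2_eq_2)
  qed
qed

text \<open>The central extension analysed above is cut out of the second term \<open>D\<close> of the series
over the first term \<open>C\<close>. A first term of order two is impossible by \<open>not_two_cosets\<close>, so
\<open>p = 2\<close> and \<open>b\<close> acts on \<open>C\<close> with exponent \<open>3\<close> modulo \<open>4\<close>. This is not a square
modulo \<open>4\<close>, so \<open>b\<close> is itself the generator of \<open>D\<close> modulo \<open>C\<close>, whence \<open>D\<close> has index two
over \<open>C\<close>. By \<open>not_two_cosets\<close> again the series stops at \<open>D\<close>.\<close>

lemma (in prime_exponent_group) cyclic_LC_factors_imp_maximal_class:
  assumes cyc: "\<And>i. i < k \<Longrightarrow> cyclic_group (LC_factor G i)"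
    and top: "LC_series G k = carrier G" and proper: "LC_series G (k - 1) \<noteq> carrier G" and "k > 1"
  shows "k = 2 \<and> p = 2 \<and> ((\<exists>n\<ge>3. G \<cong> dihedral_2group n) \<or>
    (\<exists>n\<ge>4. G \<cong> semidihedral_2group n) \<or> (\<exists>n\<ge>4. G \<cong> quaternion_2group n))"
proof -
  define C D where "C = LC_series G (Suc 0)" and "D = LC_series G (Suc (Suc 0))"
  have C: "C \<lhd> G" and D: "D \<lhd> G"
    using LC_series_normal[OF is_group] unfolding C_def D_def by blast+
  interpret C: normal C G by fact
  interpret D: normal D G by fact
  have "C \<noteq> D"
  proof
    assume "C = D"
    then have "LC_series G j = C" if "j > 0" for j
      using LC_series_stationary[of 0 j] that unfolding C_def D_def by blast
    then show False using top proper \<open>k > 1\<close> by (metis diff_is_0_eq gr0I less_trans not_less zero_less_one)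
  qed
  obtain a where a: "a \<in> C" and "\<And>x. x \<in> C \<Longrightarrow> \<exists>n::nat. \<exists>c\<in>LC_series G 0. x = c \<otimes> a [^] n"
    using cyclic_LC_factorE[OF cyc[of 0]] \<open>k > 1\<close> unfolding C_def by (metis less_trans zero_less_one)
  moreover have ac: "a \<in> carrier G" using a C.mem_carrier by blast
  ultimately have C_cyclic: "\<exists>n::nat. x = a [^] n" if "x \<in> C" for x using that by fastforce
  have LCM: "LCM_set G \<subseteq> C" by (auto simp: C_def LC_def generate.incl)
  obtain h where h: "h \<in> D" and D_cyclic: "\<And>x. x \<in> D \<Longrightarrow> \<exists>n::nat. \<exists>c\<in>C. x = c \<otimes> h [^] n"
    using cyclic_LC_factorE[OF cyc[of "Suc 0"]] \<open>k > 1\<close> unfolding C_def D_def by (metis One_nat_def)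
  have hc: "h \<in> carrier G" using h D.mem_carrier by blast
  have "h \<notin> C"
  proof
    assume "h \<in> C"
    then have "D \<subseteq> C"
      using D_cyclic subgroup_nat_pow_closed[OF C.subgroup_axioms] C.m_closed by blast
    moreover have "C \<subseteq> D" unfolding C_def D_def by (rule LC_series_mono_Suc)
    ultimately show False using \<open>C \<noteq> D\<close> by blast
  qed
  then obtain t where t: "h [^] (p ^ t) \<notin> C" "(h [^] (p ^ t)) [^] p \<in> C"
    "\<And>g. g \<in> carrier G \<Longrightarrow> \<exists>c\<in>C. g \<otimes> h [^] (p ^ t) = c \<otimes> h [^] (p ^ t) \<otimes> g"
    using cyclic_section_order_p[OF C D h _ D_cyclic] by blast
  have normalizes: "\<exists>r::nat. g \<otimes> a = a [^] r \<otimes> g" if "g \<in> carrier G" for g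
    using normal_conj_mult[OF C a that] C_cyclic by metis
  define b where "b = h [^] (p ^ t)"
  have bc: "b \<in> carrier G" using hc by (simp add: b_def)
  obtain r :: nat where r: "b \<otimes> a = a [^] r \<otimes> b" using normalizes[OF bc] by blast
  note ext = central_extension_of_LCM_cyclic[OF C a C_cyclic LCM bc t(1)[folded b_def] t(2)[folded b_def] r
      t(3)[folded b_def]]
  then obtain j where p2: "p = 2" and r34: "a [^] (2::nat) = \<one> \<or> [r = 3] (mod 4)" and j: "b [^] p = a [^] (p * j)"
    by blast
  have a2: "a [^] (2::nat) \<noteq> \<one>"
  proof
    assume "a [^] (2::nat) = \<one>"
    then have "at_most_two_cosets {\<one>} C"
      using at_most_two_cosetsI[OF one_is_normal ac, of C] C_cyclic ac
      by (metis insertI1 l_one nat_pow_closed)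
    then show False
      using not_two_cosets[OF cyc top proper, of 0] \<open>k > 1\<close> by (simp add: C_def)
  qed
  then have r3: "[r = 3] (mod 4)" using r34 by blast
  obtain s where s: "ord a = 2 ^ s" using ord_prime_power[OF ac] p2 by blast
  have "\<not> 2 ^ s dvd (2 :: nat)" using a2 ac s by (simp add: pow_eq_id)
  then have "2 \<le> s" by (cases "s = 0 \<or> s = 1") auto
  then have ord4: "4 dvd ord a" using le_imp_power_dvd[of 2 s "2::nat"] by (simp add: s)
  have "t = 0"
  proof (rule ccontr)
    assume "t \<noteq> 0"
    then obtain t' where t': "t = Suc t'" by (cases t) auto
    define g where "g = h [^] (2 ^ t' :: nat)"
    have g: "g \<in> carrier G" using hc by (simp add: g_def)
    have bg: "b = g [^] (2::nat)" using hc by (simp add: b_def g_def t' p2 nat_pow_pow mult.commute)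
    obtain \<rho> :: nat where "g \<otimes> a = a [^] \<rho> \<otimes> g" using normalizes[OF g] by blast
    then have "b \<otimes> a = a [^] (\<rho> ^ 2) \<otimes> b" unfolding bg by (rule pow_normalizes[OF g ac])
    then have "a [^] r = a [^] (\<rho> ^ 2)" using r bc ac by (metis nat_pow_closed right_cancel)
    then have "[r = \<rho> ^ 2] (mod 4)"
      using pow_eq_iff_cong[OF ac] ord4 cong_dvd_modulus_nat by blast
    then have "\<rho> ^ 2 mod 4 = 3" using r3 by (simp add: cong_def)
    moreover have "\<rho> ^ 2 mod 4 = (\<rho> mod 4) ^ 2 mod 4" by (simp add: power_mod)
    moreover have "\<rho> mod 4 \<in> {0, 1, 2, 3}" by auto
    ultimately show False by auto
  qed
  then have bh: "b = h" using hc by (simp add: b_def)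
  have h2: "h [^] (2::nat) \<in> C" using t(2) p2 bh unfolding b_def[symmetric] by simp
  have "at_most_two_cosets C D"
    by (rule at_most_two_cosetsI[OF C hc h2 D_cyclic])
  then have "\<not> Suc 0 + 2 \<le> k"
    using not_two_cosets[OF cyc top proper, of "Suc 0", folded C_def D_def] by blast
  then have k2: "k = 2" using \<open>k > 1\<close> by simp
  then have DG: "D = carrier G" using top by (simp only: D_def k2 numeral_2_eq_2)
  have cover: "\<exists>i::nat. x = a [^] i \<or> x = a [^] i \<otimes> b" if x: "x \<in> carrier G" for x
  proof -
    obtain n c where nc: "c \<in> C" "x = c \<otimes> h [^] (n::nat)" using D_cyclic x unfolding DG by blast
    have "h [^] n = (h [^] (2::nat)) [^] (n div 2) \<otimes> h [^] (n mod 2)"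
      using hc by (simp add: nat_pow_pow nat_pow_mult)
    moreover define d where "d = c \<otimes> (h [^] (2::nat)) [^] (n div 2)"
    ultimately have "x = d \<otimes> h [^] (n mod 2)"
      using nc hc C.mem_carrier by (simp add: m_assoc)
    moreover have "d \<in> C"
      using nc h2 subgroup_nat_pow_closed[OF C.subgroup_axioms] C.m_closed by (simp add: d_def)
    moreover have "n mod 2 = 0 \<or> n mod 2 = 1" by auto
    ultimately have "x \<in> C \<or> (\<exists>d\<in>C. x = d \<otimes> b)" using bh hc C.mem_carrier by auto
    then show ?thesis using C_cyclic by blast
  qed
  have "b \<noteq> a [^] i" for i :: nat
    using t(1) a subgroup_nat_pow_closed[OF C.subgroup_axioms a] unfolding b_def by metis
  moreover have "b \<notin> LCM_set G" using t(1) LCM unfolding b_def by blast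
  ultimately show ?thesis
    using maximal_class_2_group[OF p2 ac bc r r3 a2 j[unfolded p2] cover] k2 p2 by blast
qed

theorem theorem1p6:
  fixes G :: "('a, 'b) monoid_scheme" and p k :: nat
  assumes "prime p"
    and "group G"
    and "finite (carrier G)"
    and "\<exists>a. order G = p ^ a"
    and "\<not> comm_group G"
    and "has_LC_class G k"
    and "k > 1"
  shows "(\<forall>i. 0 \<le> i \<and> i \<le> k - 1 \<longrightarrow> cyclic_group (LC_factor G i)) \<longleftrightarrow>
    k = 2 \<and> p = 2 \<and>
    ((\<exists>n\<ge>3. G \<cong> dihedral_2group n) \<or>
     (\<exists>n\<ge>4. G \<cong> semidihedral_2group n) \<or>
     (\<exists>m\<ge>4. G \<cong> quaternion_2group m))"
    (is "?cyclic \<longleftrightarrow> k = 2 \<and> p = 2 \<and> ?models")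
proof -
  obtain e where e: "order G = p ^ e" using assms(4) by blast
  interpret group G by fact
  interpret prime_exponent_group G p e
  proof
    show "prime p" by fact
    show "x [^]\<^bsub>G\<^esub> (p ^ e) = \<one>\<^bsub>G\<^esub>" if "x \<in> carrier G" for x
      using pow_order_eq_1[OF that] by (simp add: e)
  qed
  have top: "LC_series G k = carrier G" and proper: "LC_series G (k - 1) \<noteq> carrier G"
    using \<open>has_LC_class G k\<close> by (auto simp: has_LC_class_def)
  show ?thesis
  proof
    assume ?cyclic
    then have "cyclic_group (LC_factor G i)" if "i < k" for i
      using that by simp
    then show "k = 2 \<and> p = 2 \<and> ?models"
      using cyclic_LC_factors_imp_maximal_class[OF _ top proper \<open>k > 1\<close>] by blast
  next
    assume *: "k = 2 \<and> p = 2 \<and> ?models"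
    then obtain N :: nat and r s :: int
      where "N > 0" "group (cyclic_by_two N r s)" "G \<cong> cyclic_by_two N r s"
    proof (elim conjE disjE exE)
      fix n assume "G \<cong> dihedral_2group n"
      then show thesis
        using that[of "2 ^ (n - 1)" "-1" 0] group_dihedral_2group[of n] by (simp add: dihedral_2group_def)
    next
      fix n :: nat assume "4 \<le> n" "G \<cong> semidihedral_2group n"
      then show thesis
        using that[of "2 ^ (n - 1)" "2 ^ (n - 2) - 1" 0] group_semidihedral_2group[of n]
        by (simp add: semidihedral_2group_def)
    next
      fix n :: nat assume "4 \<le> n" "G \<cong> quaternion_2group n"
      then show thesis
        using that[of "2 ^ (n - 1)" "-1" "2 ^ (n - 2)"] group_quaternion_2group[of n]
        by (simp add: quaternion_2group_def)
    qed
    then obtain a b and \<rho> :: nat where "a \<in> carrier G" "b \<in> carrier G" "b \<otimes>\<^bsub>G\<^esub> a = a [^]\<^bsub>G\<^esub> \<rho> \<otimes>\<^bsub>G\<^esub> b"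
      "\<And>x. x \<in> carrier G \<Longrightarrow> \<exists>i::nat. x = a [^]\<^bsub>G\<^esub> i \<or> x = a [^]\<^bsub>G\<^esub> i \<otimes>\<^bsub>G\<^esub> b"
      using iso_cyclic_by_twoD by metis
    then show ?cyclic
      using maximal_class_LC_series[of a b \<rho>] top proper * by simp
  qed
qed

end
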